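(* Let $d\ge1$, $0<c_j<1$ for $j\in D=\{1,\dots,d\}$, let $\mathbf{X}_0$ and $\mathbf{Y}_n=(Y_{n,1},\dots,Y_{n,d})$, $n\ge1$, be independent random vectors in $\mathbb{R}^d$ with $\mathbf{Y}_n\sim G$ for all $n$, and let $X_{n,j}=\max(c_jX_{n-1,j},\,Y_{n,j})$ for $n\ge1$, $j\in D$. Suppose $\{\mathbf{X}_n=(X_{n,1},\dots,X_{n,d})\}$ is stationary with common distribution function $F$. If $F\in\mathcal{D}(H)$, where $H$ has margins $H_j\in\{\Lambda,\Psi_{\alpha_j},\Phi_{\alpha_j}\}$ for some $\alpha_j>0$, then $\{\mathbf{X}_n\}_{n\ge1}$ has multivariate extremal index $$\theta(\tau_1,\dots,\tau_d)=1-\frac{\log C_{H_I}\big(e^{-\tau_jc_j^{\alpha_j}},\,j\in I\big)}{\log C_H(e^{-\tau_1},\dots,e^{-\tau_d})},\qquad (\tau_1,\dots,\tau_d)\in\mathbb{R}_+^d,$$ where $I$ is the set of indices $j\in D$ for which $H_j=\Phi_{\alpha_j}$ (the numerator being $0$ if $I=\emptyset$). Moreover, $$\theta_j=\begin{cases}1, & \text{if } H_j\in\{\Lambda,\Psi_{\alpha_j}\},\\ 1-c_j^{\alpha_j}, & \text{if } H_j=\Phi_{\alpha_j},\end{cases}$$ is the extremal index of $\{X_{n,j}\}_{n\ge1}$, $j=1,\dots,d$.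
   Context: $\mathbb{R}_+^d=(0,\infty)^d$; vector inequalities are componentwise. $\Lambda(x)=\exp(-e^{-x})$; $\Psi_\alpha(x)=e^{-(-x)^\alpha}$ for $x\le0$ and $1$ for $x>0$; $\Phi_\alpha(x)=e^{-x^{-\alpha}}$ for $x>0$ and $0$ for $x\le0$. $F\in\mathcal{D}(H)$ (max-domain of attraction) means that there are constants $a_{n,j}>0$, $b_{n,j}$ with $F^n(a_{n,1}x_1+b_{n,1},\dots,a_{n,d}x_d+b_{n,d})\to H(x_1,\dots,x_d)$ as $n\to\infty$ for all $\mathbf{x}$. For a distribution function $H$ with continuous margins $H_j$, $C_H(u_1,\dots,u_d)=H(H_1^{-1}(u_1),\dots,H_d^{-1}(u_d))$ denotes its copula; $H_I$ is the marginal distribution of $H$ corresponding to the indices in $I$ and $C_{H_I}$ is its copula. Multivariate extremal index: let $\mathbf{M}_n$ be the vector of componentwise maxima of $\mathbf{X}_1,\dots,\mathbf{X}_n$ and $\widehat{\mathbf{M}}_n$ the vector of componentwise maxima of $n$ i.i.d. random vectors with distribution $F$. The stationary sequence $\{\mathbf{X}_n\}$ has multivariate extremal index $\theta(\boldsymbol{\tau})$ if for each $\boldsymbol{\tau}\in\mathbb{R}_+^d$ there exist levels $\mathbf{u}_n^{(\boldsymbol{\tau})}=(u_{n,1}^{(\tau_1)},\dots,u_{n,d}^{(\tau_d)})$ with $nP(X_{1,j}>u_{n,j}^{(\tau_j)})\to\tau_j$ for $j=1,\dots,d$, $P(\widehat{\mathbf{M}}_n\le\mathbf{u}_n^{(\boldsymbol{\tau})})\to\widehat{\gamma}(\boldsymbol{\tau})\in(0,1)$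 and $P(\mathbf{M}_n\le\mathbf{u}_n^{(\boldsymbol{\tau})})\to\widehat{\gamma}(\boldsymbol{\tau})^{\theta(\boldsymbol{\tau})}$. The extremal index of the univariate sequence $\{X_{n,j}\}_{n\ge1}$ is the case $d=1$ of this definition: a constant $\theta_j$ such that, for every $\tau_j>0$, $P(\max_{i\le n}X_{i,j}\le u_{n,j}^{(\tau_j)})\to e^{-\theta_j\tau_j}$ when $nP(X_{1,j}>u_{n,j}^{(\tau_j)})\to\tau_j$. *)

theory Defs
  imports "HOL-Probability.Probability"
begin

text \<open>
  A distribution function on \<open>\<real>\<^sup>d\<close> is represented by its Borel probability measure on
  \<^typ>\<open>real ^ 'd\<close>; the order on \<^typ>\<open>real ^ 'd\<close> is componentwise.
\<close>

definition joint_df :: "(real ^ 'd) measure \<Rightarrow> real ^ 'd \<Rightarrow> real"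
  where "joint_df N x = measure N {..x}"

definition margin :: "(real ^ 'd) measure \<Rightarrow> 'd \<Rightarrow> real \<Rightarrow> real"
  where "margin N j = cdf (distr N borel (\<lambda>y. y $ j))"

text \<open>
  The distribution function of the marginal law of the components in \<open>I\<close>. Only the components
  of \<open>x\<close> with index in \<open>I\<close> matter; \<open>I = UNIV\<close> gives \<^const>\<open>joint_df\<close>, and \<open>I = {}\<close> gives
  the constant 1 for a probability measure.
\<close>

definition marginal_df :: "(real ^ 'd) measure \<Rightarrow> 'd set \<Rightarrow> real ^ 'd \<Rightarrow> real"
  where "marginal_df N I x = measure N {y. \<forall>j\<in>I. y $ j \<le> x $ j}"

definition df_inverse :: "(real \<Rightarrow> real) \<Rightarrow> real \<Rightarrow> real"
  where "df_inverse h u = Inf {x. u \<le> h x}"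

text \<open>
  The copula of the marginal law with index set \<open>I\<close>, meant for continuous margins and
  arguments in the open unit interval.
\<close>

definition marginal_copula :: "(real ^ 'd) measure \<Rightarrow> 'd set \<Rightarrow> real ^ 'd \<Rightarrow> real"
  where "marginal_copula N I u = marginal_df N I (\<chi> j. df_inverse (margin N j) (u $ j))"

definition copula :: "(real ^ 'd) measure \<Rightarrow> real ^ 'd \<Rightarrow> real"
  where "copula N u = joint_df N (\<chi> j. df_inverse (margin N j) (u $ j))"

definition gumbel :: "real \<Rightarrow> real"
  where "gumbel x = exp (- exp (- x))"

definition weibull :: "real \<Rightarrow> real \<Rightarrow> real"
  where "weibull \<alpha> x = (if x \<le> 0 then exp (- ((- x) powr \<alpha>)) else 1)"

definition frechet :: "real \<Rightarrow> real \<Rightarrow> real"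
  where "frechet \<alpha> x = (if x > 0 then exp (- (x powr (- \<alpha>))) else 0)"

definition in_max_domain :: "(real ^ 'd) measure \<Rightarrow> (real ^ 'd) measure \<Rightarrow> bool"
  where "in_max_domain F H \<longleftrightarrow>
    (\<exists>(a :: nat \<Rightarrow> real ^ 'd) (b :: nat \<Rightarrow> real ^ 'd).
      (\<forall>n j. 0 < a n $ j) \<and>
      (\<forall>x. (\<lambda>n. joint_df F (\<chi> j. a n $ j * x $ j + b n $ j) ^ n) \<longlonglongrightarrow> joint_df H x))"

text \<open>Strict stationarity of the sequence \<open>Z\<^sub>1, Z\<^sub>2, \<dots>\<close>; the index 0 is not involved.\<close>

definition stationary_seq :: "'a measure \<Rightarrow> (nat \<Rightarrow> 'a \<Rightarrow> 'b :: topological_space) \<Rightarrow> bool"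
  where "stationary_seq M Z \<longleftrightarrow>
    (\<forall>k h. distr M (PiM {1..k} (\<lambda>_. borel)) (\<lambda>\<omega>. \<lambda>i\<in>{1..k}. Z (i + h) \<omega>) =
           distr M (PiM {1..k} (\<lambda>_. borel)) (\<lambda>\<omega>. \<lambda>i\<in>{1..k}. Z i \<omega>))"

definition comp_max :: "(nat \<Rightarrow> 'a \<Rightarrow> real ^ 'd) \<Rightarrow> nat \<Rightarrow> 'a \<Rightarrow> real ^ 'd"
  where "comp_max Z n \<omega> = (\<chi> j. MAX i\<in>{1..n}. Z i \<omega> $ j)"

text \<open>
  The level \<open>u j t n\<close> stands for \<open>u\<^bsub>n,j\<^esub>\<close> with superscript \<open>t\<close>: the level used for component
  \<open>j\<close> depends on the vector \<open>\<tau>\<close> only through \<open>\<tau> $ j\<close>. The i.i.d. vectors are the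
  coordinates of the \<open>n\<close>-fold product of the law of \<open>Z\<^sub>1\<close>.
\<close>

definition has_multivariate_extremal_index ::
    "'a measure \<Rightarrow> (nat \<Rightarrow> 'a \<Rightarrow> real ^ 'd) \<Rightarrow> (real ^ 'd \<Rightarrow> real) \<Rightarrow> bool"
  where "has_multivariate_extremal_index M Z \<theta> \<longleftrightarrow>
    (\<exists>u :: 'd \<Rightarrow> real \<Rightarrow> nat \<Rightarrow> real. \<forall>\<tau> :: real ^ 'd. (\<forall>j. 0 < \<tau> $ j) \<longrightarrow>
      (\<forall>j. (\<lambda>n. real n * \<P>(\<omega> in M. Z 1 \<omega> $ j > u j (\<tau> $ j) n)) \<longlonglongrightarrow> \<tau> $ j) \<and>
      (\<exists>\<gamma>. 0 < \<gamma> \<and> \<gamma> < 1 \<and>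
        (\<lambda>n. \<P>(\<omega> in PiM {1..n} (\<lambda>_. distr M borel (Z 1)).
               comp_max (\<lambda>i \<omega>. \<omega> i) n \<omega> \<le> (\<chi> j. u j (\<tau> $ j) n))) \<longlonglongrightarrow> \<gamma> \<and>
        (\<lambda>n. \<P>(\<omega> in M. comp_max Z n \<omega> \<le> (\<chi> j. u j (\<tau> $ j) n))) \<longlonglongrightarrow> \<gamma> powr \<theta> \<tau>))"

definition has_extremal_index :: "'a measure \<Rightarrow> (nat \<Rightarrow> 'a \<Rightarrow> real) \<Rightarrow> real \<Rightarrow> bool"
  where "has_extremal_index M Z \<theta> \<longleftrightarrow>
    (\<forall>\<tau>>0.
      (\<exists>u :: nat \<Rightarrow> real. (\<lambda>n. real n * \<P>(\<omega> in M. Z 1 \<omega> > u n)) \<longlonglongrightarrow> \<tau>) \<and>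
      (\<forall>u :: nat \<Rightarrow> real. (\<lambda>n. real n * \<P>(\<omega> in M. Z 1 \<omega> > u n)) \<longlonglongrightarrow> \<tau> \<longrightarrow>
        (\<lambda>n. \<P>(\<omega> in M. (MAX i\<in>{1..n}. Z i \<omega>) \<le> u n)) \<longlonglongrightarrow> exp (- \<theta> * \<tau>)))"

end

theory Submission imports Defs begin

text \<open>
  Maxima of the chain are explicit. Stationarity gives \<open>F(u) = F(u/c) G(u)\<close>, where \<open>u/c\<close> is taken
  componentwise, and for \<open>u \<ge> 0\<close> the path stays below \<open>u\<close> as soon as \<open>c X\<^sub>0\<close> and all innovations do:
  once \<open>X\<^bsub>i-1\<^esub> \<le> u\<close>, also \<open>c X\<^bsub>i-1\<^esub> \<le> u\<close>. Hence
  \<open>P(M\<^sub>n \<le> u) = F(u) G(u)\<^bsup>n-1\<^esup> = F(u)\<^bsup>n\<^esup> / F(u/c)\<^bsup>n-1\<^esup>\<close>, for every group of coordinates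
  separately (\<open>path_below_prob\<close>). It remains to find the limits \<open>A\<close> of \<open>n (1 - F(u\<^sub>n))\<close> and \<open>B\<close> of
  \<open>n (1 - F(u\<^sub>n/c))\<close>; then \<open>P(M\<^sub>n \<le> u\<^sub>n)\<close> tends to \<open>exp (B - A)\<close>, which is the power
  \<open>1 - B/A\<close> of the limit \<open>exp (- A)\<close> for independent vectors.

  The limit \<open>A\<close> is \<open>- log H\<close> at the point whose margins are \<open>exp (- \<tau>\<^sub>j)\<close>. For \<open>B\<close> the question is
  what division by \<open>c\<^sub>j\<close> does to a marginal tail. The relation \<open>F(u) = F(u/c) G(u)\<close> forces
  \<open>F\<^sub>j = 0\<close> on the negative half-line (\<open>margin_eq_0\<close>). If \<open>H\<^sub>j\<close> is positive everywhere
  (Gumbel and Weibull), this makes the centering constants \<open>b\<^sub>n\<close> dominate the scaling constants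
  \<open>a\<^sub>n\<close>, so \<open>u\<^sub>n/c\<close> lies infinitely many scale units above \<open>u\<^sub>n\<close> and its tail is negligible
  (\<open>light_tail_scaled_levels\<close>). In the Frechet case \<open>b\<^sub>n/a\<^sub>n\<close> tends to 0, by comparing the constants
  with index \<open>n\<close> and \<open>n/2\<close>; division by \<open>c\<close> then acts on the limit variable itself and
  turns \<open>\<tau>\<close> into \<open>\<tau> c\<^bsup>\<alpha>\<^esup>\<close> (\<open>frechet_tail_scaled_levels\<close>).

  The passage from margins to joint laws uses that a joint distribution function is Lipschitz
  in its margins. So \<open>n (1 - F(v\<^sub>n))\<close> has the same limit for any two level sequences with the same
  marginal tail limits, and coordinates with negligible tails can be dropped
  (\<open>marginal_df_tail_tendsto\<close>, \<open>marginal_df_tail_extend\<close>). This gives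
  \<open>B = - log H\<^sub>I\<close> at the point whose margins are \<open>exp (- \<tau>\<^sub>j c\<^sub>j\<^bsup>\<alpha>\<^esup>)\<close>.
\<close>

section \<open>Powers of probabilities close to one\<close>

text \<open>
  Because of \<open>1 - p \<le> - ln p \<le> (1 - p) / p\<close>, both limits say that \<open>- k ln p\<close> tends to \<open>t\<close>. The
  exponent is a separate sequence: besides \<open>n\<close>, the values \<open>n - 1\<close> (transitions along a path) and
  \<open>n div 2\<close> (comparison of normalizing constants) occur.
\<close>
lemma tendsto_power_exp_iff:
  fixes p :: "nat \<Rightarrow> real" and k :: "nat \<Rightarrow> nat"
  assumes k: "filterlim k at_top sequentially" and p0: "\<And>n. 0 \<le> p n" and p1: "\<And>n. p n \<le> 1"
  shows "(\<lambda>n. p n ^ k n) \<longlonglongrightarrow> exp (- t) \<longleftrightarrow> (\<lambda>n. real (k n) * (1 - p n)) \<longlonglongrightarrow> t"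
proof -
  have kr: "filterlim (\<lambda>n. real (k n)) at_top sequentially"
    by (rule filterlim_compose[OF filterlim_real_sequentially k])
  have kpos: "\<forall>\<^sub>F n in sequentially. 0 < k n"
    by (rule eventually_compose_filterlim[OF eventually_gt_at_top k])
  have lower: "real (k n) * (1 - p n) \<le> - (real (k n) * ln (p n))" if "0 < p n" for n
    using ln_le_minus_one[OF that] mult_left_mono[of "ln (p n)" "p n - 1" "real (k n)"]
    by (simp add: algebra_simps)
  have upper: "- (real (k n) * ln (p n)) \<le> real (k n) * (1 - p n) / p n" if "0 < p n" for n
  proof -
    have "- ln (p n) \<le> (1 - p n) / p n"
      using ln_le_minus_one[of "1 / p n"] that by (simp add: ln_div field_simps)
    from mult_left_mono[OF this, of "real (k n)"] show ?thesis by simp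
  qed
  show ?thesis
  proof
    assume lim: "(\<lambda>n. p n ^ k n) \<longlonglongrightarrow> exp (- t)"
    have ev: "\<forall>\<^sub>F n in sequentially. 0 < p n"
      using order_tendstoD(1)[OF lim exp_gt_zero] kpos
    proof eventually_elim
      case (elim n)
      then show ?case using p0[of n] by (cases "p n = 0") (auto simp: zero_power)
    qed
    have "(\<lambda>n. ln (p n ^ k n)) \<longlonglongrightarrow> - t"
      using tendsto_ln[OF lim] by simp
    then have klog: "(\<lambda>n. real (k n) * ln (p n)) \<longlonglongrightarrow> - t"
      by (rule Lim_transform_eventually) (use ev in eventually_elim, simp add: ln_realpow)
    have "(\<lambda>n. real (k n) * ln (p n) / real (k n)) \<longlonglongrightarrow> 0"
      by (rule real_tendsto_divide_at_top[OF klog kr])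
    then have "(\<lambda>n. ln (p n)) \<longlonglongrightarrow> 0"
      by (rule Lim_transform_eventually) (use kpos in eventually_elim, simp)
    from tendsto_exp[OF this] have "(\<lambda>n. exp (ln (p n))) \<longlonglongrightarrow> 1" by simp
    then have plim: "p \<longlonglongrightarrow> 1"
      by (rule Lim_transform_eventually) (use ev in eventually_elim, simp)
    show "(\<lambda>n. real (k n) * (1 - p n)) \<longlonglongrightarrow> t"
    proof (rule tendsto_sandwich)
      show "\<forall>\<^sub>F n in sequentially. - (real (k n) * ln (p n)) * p n \<le> real (k n) * (1 - p n)"
        using ev by eventually_elim (use upper in \<open>simp add: pos_le_divide_eq\<close>)
      show "\<forall>\<^sub>F n in sequentially. real (k n) * (1 - p n) \<le> - (real (k n) * ln (p n))"
        using ev by eventually_elim (rule lower)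
      show "(\<lambda>n. - (real (k n) * ln (p n)) * p n) \<longlonglongrightarrow> t"
        using tendsto_mult[OF tendsto_minus[OF klog] plim] by simp
      show "(\<lambda>n. - (real (k n) * ln (p n))) \<longlonglongrightarrow> t"
        using tendsto_minus[OF klog] by simp
    qed
  next
    assume lim: "(\<lambda>n. real (k n) * (1 - p n)) \<longlonglongrightarrow> t"
    have "(\<lambda>n. real (k n) * (1 - p n) / real (k n)) \<longlonglongrightarrow> 0"
      by (rule real_tendsto_divide_at_top[OF lim kr])
    then have "(\<lambda>n. 1 - p n) \<longlonglongrightarrow> 0"
      by (rule Lim_transform_eventually) (use kpos in eventually_elim, simp)
    from tendsto_diff[OF tendsto_const[of 1] this] have plim: "p \<longlonglongrightarrow> 1" by simp
    have ev: "\<forall>\<^sub>F n in sequentially. 0 < p n"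
      using order_tendstoD(1)[OF plim, of 0] by simp
    have "(\<lambda>n. - (real (k n) * ln (p n))) \<longlonglongrightarrow> t"
    proof (rule tendsto_sandwich)
      show "\<forall>\<^sub>F n in sequentially. real (k n) * (1 - p n) \<le> - (real (k n) * ln (p n))"
        using ev by eventually_elim (rule lower)
      show "\<forall>\<^sub>F n in sequentially. - (real (k n) * ln (p n)) \<le> real (k n) * (1 - p n) / p n"
        using ev by eventually_elim (rule upper)
      show "(\<lambda>n. real (k n) * (1 - p n) / p n) \<longlonglongrightarrow> t"
        using tendsto_divide[OF lim plim] by simp
    qed (rule lim)
    from tendsto_exp[OF tendsto_minus[OF this]]
    have "(\<lambda>n. exp (real (k n) * ln (p n))) \<longlonglongrightarrow> exp (- t)" by simp
    then show "(\<lambda>n. p n ^ k n) \<longlonglongrightarrow> exp (- t)"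
      by (rule Lim_transform_eventually)
        (use ev in eventually_elim, simp add: exp_of_nat_mult)
  qed
qed

lemmas tendsto_self_power_exp_iff = tendsto_power_exp_iff[OF filterlim_ident]

text \<open>
  The model case is three events with \<open>A \<inter> C \<subseteq> B\<close>, of probabilities \<open>p\<close>, \<open>r\<close>, \<open>q\<close>: in \<open>n\<close>
  independent trials, if \<open>A\<close> and \<open>C\<close> always occur, so does \<open>B\<close>. The error \<open>1 - r ^ n\<close> converges
  along levels, which the trivial bound \<open>n (1 - r)\<close> need not do when \<open>r ^ n\<close> tends to 0.
\<close>
lemma power_diff_le_one_minus_power:
  fixes p q r :: real
  assumes "0 \<le> q" "q \<le> p" "p \<le> 1" "q \<le> r" "r \<le> 1" "p - q \<le> 1 - r"
  shows "p ^ n - q ^ n \<le> 1 - r ^ n"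
proof (induction n)
  case (Suc n)
  have "p ^ Suc n - q ^ Suc n = p * (p ^ n - q ^ n) + (p - q) * q ^ n"
    by (simp add: algebra_simps)
  also have "\<dots> \<le> 1 * (1 - r ^ n) + (1 - r) * r ^ n"
  proof (rule add_mono)
    have "p * (p ^ n - q ^ n) \<le> 1 * (p ^ n - q ^ n)"
      using assms by (intro mult_right_mono) (auto intro: power_mono)
    then show "p * (p ^ n - q ^ n) \<le> 1 * (1 - r ^ n)" using Suc by simp
    show "(p - q) * q ^ n \<le> (1 - r) * r ^ n"
      using assms by (intro mult_mono power_mono) auto
  qed
  also have "\<dots> = 1 - r ^ Suc n" by (simp add: algebra_simps)
  finally show ?case .
qed simp

text \<open>
  Every halving of the index contracts by some \<open>q < 1\<close> up to an error \<open>\<delta>\<close>. The errors add up to at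
  most \<open>\<delta> / (1 - q)\<close>, and the number of halvings before a fixed index is reached grows with \<open>m\<close>.
\<close>
lemma halving_recursion_tendsto_0:
  fixes \<beta> \<kappa> \<epsilon> :: "nat \<Rightarrow> real"
  assumes rec: "\<And>m. \<beta> m = \<kappa> m * \<beta> (m div 2) + \<epsilon> m"
    and \<kappa>: "\<kappa> \<longlonglongrightarrow> \<kappa>0" "\<bar>\<kappa>0\<bar> < 1" and \<epsilon>: "\<epsilon> \<longlonglongrightarrow> 0"
  shows "\<beta> \<longlonglongrightarrow> 0"
proof (rule tendstoI)
  fix e :: real assume "0 < e"
  obtain q where q: "\<bar>\<kappa>0\<bar> < q" "q < 1" using \<kappa>(2) dense by blast
  then have q0: "0 < q" by linarith
  \<comment> \<open>chosen so that the accumulated errors \<open>\<delta> / (1 - q)\<close> equal \<open>e / 2\<close>\<close>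
  define \<delta> where "\<delta> = (e / 2) * (1 - q)"
  have \<delta>0: "0 < \<delta>" using \<open>0 < e\<close> q by (simp add: \<delta>_def)
  have "\<forall>\<^sub>F m in sequentially. \<bar>\<kappa> m\<bar> < q"
    using order_tendstoD(2)[OF tendsto_rabs[OF \<kappa>(1)] q(1)] .
  moreover have "\<forall>\<^sub>F m in sequentially. \<bar>\<epsilon> m\<bar> < \<delta>"
    using order_tendstoD(2)[OF tendsto_rabs[OF \<epsilon>]] \<delta>0 by simp
  ultimately have "\<forall>\<^sub>F m in sequentially. \<bar>\<kappa> m\<bar> < q \<and> \<bar>\<epsilon> m\<bar> < \<delta>"
    by eventually_elim simp
  then obtain N0 where N0: "\<And>m. N0 \<le> m \<Longrightarrow> \<bar>\<kappa> m\<bar> < q \<and> \<bar>\<epsilon> m\<bar> < \<delta>"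
    by (auto simp: eventually_sequentially)
  \<comment> \<open>positive, so that \<open>m div 2 < m\<close> for \<open>m \<ge> N\<close>\<close>
  define N where "N = Suc N0"
  have step: "\<bar>\<beta> m\<bar> \<le> q * \<bar>\<beta> (m div 2)\<bar> + \<delta>" if "N \<le> m" for m
  proof -
    have "\<bar>\<beta> m\<bar> \<le> \<bar>\<kappa> m\<bar> * \<bar>\<beta> (m div 2)\<bar> + \<bar>\<epsilon> m\<bar>"
      by (subst rec) (metis abs_mult abs_triangle_ineq)
    also have "\<dots> \<le> q * \<bar>\<beta> (m div 2)\<bar> + \<delta>"
      using N0[of m] that by (intro add_mono mult_right_mono) (auto simp: N_def)
    finally show ?thesis .
  qed
  define K where "K = (\<Sum>i<N. \<bar>\<beta> i\<bar>)"
  have bound: "\<bar>\<beta> m\<bar> \<le> q ^ j * K + e / 2" if "j = 0 \<or> 2 ^ j * N \<le> m" for j m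
    using that
  proof (induction j arbitrary: m)
    case 0
    have "\<bar>\<beta> m\<bar> \<le> K + e / 2"
    proof (induction m rule: less_induct)
      case (less m)
      show ?case
      proof (cases "m < N")
        case True
        then have "\<bar>\<beta> m\<bar> \<le> K" unfolding K_def by (intro member_le_sum) auto
        then show ?thesis using \<open>0 < e\<close> by simp
      next
        case False
        have "\<bar>\<beta> m\<bar> \<le> q * \<bar>\<beta> (m div 2)\<bar> + \<delta>" using step False by simp
        also have "\<dots> \<le> q * (K + e / 2) + \<delta>"
          using less[of "m div 2"] False q0 by (intro add_mono mult_left_mono) (auto simp: N_def)
        also have "\<dots> = q * K + e / 2" by (simp add: \<delta>_def field_simps)
        also have "\<dots> \<le> 1 * K + e / 2"
          using q by (intro add_mono mult_right_mono) (auto simp: K_def sum_nonneg)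
        finally show ?thesis by simp
      qed
    qed
    then show ?case by simp
  next
    case (Suc j)
    have le: "2 ^ j * N \<le> m div 2" using Suc.prems by simp
    have "1 * N \<le> 2 ^ j * N" by (intro mult_le_mono1) simp
    then have "N \<le> m" using le by linarith
    have "\<bar>\<beta> m\<bar> \<le> q * \<bar>\<beta> (m div 2)\<bar> + \<delta>" using step \<open>N \<le> m\<close> by simp
    also have "\<dots> \<le> q * (q ^ j * K + e / 2) + \<delta>"
      using Suc.IH[of "m div 2"] le q0 by (intro add_mono mult_left_mono) auto
    also have "\<dots> = q ^ Suc j * K + e / 2" by (simp add: \<delta>_def field_simps)
    finally show ?case .
  qed
  have "(\<lambda>j. q ^ j * K) \<longlonglongrightarrow> 0"
    using tendsto_mult[OF LIMSEQ_realpow_zero[of q] tendsto_const[of K]] q q0 by simp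
  then have "\<forall>\<^sub>F j in sequentially. q ^ j * K < e / 2"
    using order_tendstoD(2) \<open>0 < e\<close> by (metis half_gt_zero)
  then obtain j where j: "q ^ j * K < e / 2" by (auto simp: eventually_sequentially)
  show "\<forall>\<^sub>F m in sequentially. dist (\<beta> m) 0 < e"
    using eventually_ge_at_top[of "2 ^ j * N"]
    by eventually_elim (use bound[of j] j in force)
qed

section \<open>Levels in a univariate domain of attraction\<close>

text \<open>
  One half of convergence of types: comparing powers of \<open>f\<close> at \<open>v m\<close> and at \<open>a y + b\<close> decides on
  which side of \<open>y\<close> the normalized level lies, since \<open>h\<close> separates \<open>x0\<close> from every other point. The
  constants are those of index \<open>k m\<close>, so that levels of index \<open>m\<close> can be measured in the
  units of another index.
\<close>
lemma normalized_levels_tendsto: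
  fixes f h :: "real \<Rightarrow> real" and a b v :: "nat \<Rightarrow> real" and k :: "nat \<Rightarrow> nat"
  assumes f: "mono f" "\<And>x. 0 \<le> f x" and a: "\<And>n. 0 < a n"
    and k: "filterlim k at_top sequentially"
    and dom: "\<And>x. (\<lambda>n. f (a n * x + b n) ^ n) \<longlonglongrightarrow> h x"
    and v: "(\<lambda>m. f (v m) ^ k m) \<longlonglongrightarrow> h x0"
    and less: "\<And>y. y < x0 \<Longrightarrow> h y < h x0" and greater: "\<And>y. x0 < y \<Longrightarrow> h x0 < h y"
  shows "(\<lambda>m. (v m - b (k m)) / a (k m)) \<longlonglongrightarrow> x0"
proof -
  have dom_k: "(\<lambda>m. f (a (k m) * x + b (k m)) ^ k m) \<longlonglongrightarrow> h x" for x
    by (rule filterlim_compose[OF dom k])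
  have cmp: "x < y" if "f x ^ n < f y ^ n" for x y n
    using that power_mono[OF monoD[OF f(1), of y x] f(2), of n] by (meson not_le)
  show ?thesis
  proof (rule order_tendstoI)
    fix y assume "y < x0"
    obtain r where r: "h y < r" "r < h x0" using less[OF \<open>y < x0\<close>] dense by blast
    show "\<forall>\<^sub>F m in sequentially. y < (v m - b (k m)) / a (k m)"
      using order_tendstoD(2)[OF dom_k r(1)] order_tendstoD(1)[OF v r(2)]
    proof eventually_elim
      case (elim m)
      then have "a (k m) * y + b (k m) < v m" using cmp order.strict_trans by blast
      then show ?case using a[of "k m"] by (simp add: pos_less_divide_eq algebra_simps)
    qed
  next
    fix y assume "x0 < y"
    obtain r where r: "h x0 < r" "r < h y" using greater[OF \<open>x0 < y\<close>] dense by blast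
    show "\<forall>\<^sub>F m in sequentially. (v m - b (k m)) / a (k m) < y"
      using order_tendstoD(1)[OF dom_k r(2)] order_tendstoD(2)[OF v r(1)]
    proof eventually_elim
      case (elim m)
      then have "v m < a (k m) * y + b (k m)" using cmp order.strict_trans by blast
      then show ?case using a[of "k m"] by (simp add: pos_divide_less_eq algebra_simps)
    qed
  qed
qed

text \<open>
  The converse direction: by monotonicity of \<open>f\<close>, the powers are squeezed between those at
  points \<open>a x + b\<close> with fixed \<open>x\<close> on either side of \<open>y\<close>.
\<close>
lemma domain_power_tendsto:
  fixes f h :: "real \<Rightarrow> real" and a b v :: "nat \<Rightarrow> real"
  assumes f: "mono f" "\<And>x. 0 \<le> f x" and a: "\<And>n. 0 < a n"
    and dom: "\<And>x. (\<lambda>n. f (a n * x + b n) ^ n) \<longlonglongrightarrow> h x"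
    and w: "(\<lambda>n. (v n - b n) / a n) \<longlonglongrightarrow> y" and cont: "isCont h y"
  shows "(\<lambda>n. f (v n) ^ n) \<longlonglongrightarrow> h y"
proof -
  have lim_h: "(\<lambda>n. h (y + s / real (Suc n))) \<longlonglongrightarrow> h y" for s
  proof (rule isCont_tendsto_compose[OF cont])
    show "(\<lambda>n. y + s / real (Suc n)) \<longlonglongrightarrow> y"
      using tendsto_add[OF tendsto_const[of y] tendsto_mult[OF tendsto_const[of s] LIMSEQ_inverse_real_of_nat]]
      by (simp add: divide_inverse)
  qed
  have below: "\<forall>\<^sub>F n in sequentially. r < f (v n) ^ n" if "x < y" "r < h x" for r x
    using order_tendstoD(1)[OF dom that(2)] order_tendstoD(1)[OF w that(1)]
  proof eventually_elim
    case (elim n)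
    then have "a n * x + b n \<le> v n" using a[of n] by (simp add: pos_less_divide_eq algebra_simps)
    then have "f (a n * x + b n) ^ n \<le> f (v n) ^ n" by (intro power_mono monoD[OF f(1)] f(2))
    then show ?case using elim by linarith
  qed
  have above: "\<forall>\<^sub>F n in sequentially. f (v n) ^ n < r" if "y < x" "h x < r" for r x
    using order_tendstoD(2)[OF dom that(2)] order_tendstoD(2)[OF w that(1)]
  proof eventually_elim
    case (elim n)
    then have "v n \<le> a n * x + b n" using a[of n] by (simp add: pos_divide_less_eq algebra_simps)
    then have "f (v n) ^ n \<le> f (a n * x + b n) ^ n" by (intro power_mono monoD[OF f(1)] f(2))
    then show ?case using elim by linarith
  qed
  show ?thesis
  proof (rule order_tendstoI)
    fix r assume "r < h y"
    then have "\<forall>\<^sub>F n in sequentially. r < h (y + (- 1) / real (Suc n))"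
      by (rule order_tendstoD(1)[OF lim_h])
    then obtain n where "r < h (y + (- 1) / real (Suc n))"
      by (auto simp: eventually_sequentially)
    then show "\<forall>\<^sub>F n in sequentially. r < f (v n) ^ n"
      by (intro below[of "y + (- 1) / real (Suc n)"]) auto
  next
    fix r assume "h y < r"
    then have "\<forall>\<^sub>F n in sequentially. h (y + 1 / real (Suc n)) < r"
      by (rule order_tendstoD(2)[OF lim_h])
    then obtain n where "h (y + 1 / real (Suc n)) < r"
      by (auto simp: eventually_sequentially)
    then show "\<forall>\<^sub>F n in sequentially. f (v n) ^ n < r"
      by (intro above[of "y + 1 / real (Suc n)"]) auto
  qed
qed

lemma domain_power_tendsto_1:
  fixes f h :: "real \<Rightarrow> real" and a b v :: "nat \<Rightarrow> real"
  assumes f: "mono f" "\<And>x. 0 \<le> f x" "\<And>x. f x \<le> 1" and a: "\<And>n. 0 < a n"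
    and dom: "\<And>x. (\<lambda>n. f (a n * x + b n) ^ n) \<longlonglongrightarrow> h x"
    and w: "filterlim (\<lambda>n. (v n - b n) / a n) at_top sequentially"
    and h1: "(h \<longlongrightarrow> 1) at_top"
  shows "(\<lambda>n. f (v n) ^ n) \<longlonglongrightarrow> 1"
proof (rule order_tendstoI)
  fix r :: real assume "r < 1"
  from order_tendstoD(1)[OF h1 this] obtain x where x: "r < h x"
    by (auto simp: eventually_at_top_linorder)
  show "\<forall>\<^sub>F n in sequentially. r < f (v n) ^ n"
    using order_tendstoD(1)[OF dom x] eventually_compose_filterlim[OF eventually_ge_at_top[of x] w]
  proof eventually_elim
    case (elim n)
    then have "a n * x + b n \<le> v n" using a[of n] by (simp add: pos_le_divide_eq algebra_simps)
    then have "f (a n * x + b n) ^ n \<le> f (v n) ^ n" by (intro power_mono monoD[OF f(1)] f(2))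
    then show ?case using elim by linarith
  qed
next
  fix r :: real assume "1 < r"
  then show "\<forall>\<^sub>F n in sequentially. f (v n) ^ n < r"
    using power_le_one[OF f(2) f(3)] by (intro always_eventually allI) (meson le_less_trans)
qed

section \<open>The three extreme value distributions\<close>

lemma gumbel_inverse:
  assumes "0 < t"
  obtains x where "gumbel x = exp (- t)" "\<And>y. y < x \<Longrightarrow> gumbel y < gumbel x"
    "\<And>y. x < y \<Longrightarrow> gumbel x < gumbel y"
proof (rule that[of "- ln t"])
  show "gumbel (- ln t) = exp (- t)" using assms by (simp add: gumbel_def)
qed (auto simp: gumbel_def)

lemma weibull_inverse:
  assumes "0 < t" "0 < \<alpha>"
  obtains x where "weibull \<alpha> x = exp (- t)" "\<And>y. y < x \<Longrightarrow> weibull \<alpha> y < weibull \<alpha> x"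
    "\<And>y. x < y \<Longrightarrow> weibull \<alpha> x < weibull \<alpha> y"
proof (rule that[of "- (t powr (1 / \<alpha>))"])
  have x: "0 < t powr (1 / \<alpha>)" using assms by simp
  show "weibull \<alpha> (- (t powr (1 / \<alpha>))) = exp (- t)"
    using assms by (simp add: weibull_def powr_powr)
  have eq: "weibull \<alpha> z = exp (- ((- z) powr \<alpha>))" if "z \<le> 0" for z
    using that by (simp add: weibull_def)
  show "weibull \<alpha> y < weibull \<alpha> (- (t powr (1 / \<alpha>)))" if "y < - (t powr (1 / \<alpha>))" for y
  proof -
    have "y \<le> 0" "- (t powr (1 / \<alpha>)) \<le> 0" using that x by linarith+
    from this[THEN eq] show ?thesis
      using powr_less_mono2[of \<alpha> "t powr (1 / \<alpha>)" "- y"] that assms by simp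
  qed
  show "weibull \<alpha> (- (t powr (1 / \<alpha>))) < weibull \<alpha> y" if "- (t powr (1 / \<alpha>)) < y" for y
  proof (cases "y \<le> 0")
    case True
    have "- (t powr (1 / \<alpha>)) \<le> 0" using x by linarith
    from eq[OF True] eq[OF this] show ?thesis
      using powr_less_mono2[of \<alpha> "- y" "t powr (1 / \<alpha>)"] that True assms by simp
  next
    case False
    have "- (t powr (1 / \<alpha>)) \<le> 0" using x by linarith
    from eq[OF this] show ?thesis using False assms by (simp add: weibull_def powr_powr)
  qed
qed

lemma frechet_less:
  assumes "0 < \<alpha>" "0 < y" "x < y"
  shows "frechet \<alpha> x < frechet \<alpha> y"
proof (cases "0 < x")
  case True
  have "y powr (- \<alpha>) < x powr (- \<alpha>)" by (rule powr_less_mono2_neg) (use True assms in auto)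
  then show ?thesis using True assms(2) unfolding frechet_def by simp
qed (use assms in \<open>simp add: frechet_def\<close>)

text \<open>
  The homogeneity that produces the factor \<open>c powr \<alpha>\<close> in the extremal index.
\<close>
lemma frechet_scale:
  assumes "0 < \<alpha>" "0 < x" "0 < t"
  shows "frechet \<alpha> (t powr (- (1 / \<alpha>)) * x) = exp (- (t * x powr (- \<alpha>)))"
proof -
  have "(t powr (- (1 / \<alpha>)) * x) powr (- \<alpha>) = (t powr (- (1 / \<alpha>))) powr (- \<alpha>) * x powr (- \<alpha>)"
    using assms by (intro powr_mult)
  also have "(t powr (- (1 / \<alpha>))) powr (- \<alpha>) = t"
    unfolding powr_powr using assms by simp
  finally show ?thesis using assms by (simp add: frechet_def)
qed

lemma frechet_inverse:
  assumes "0 < t" "0 < \<alpha>"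
  obtains x where "frechet \<alpha> x = exp (- t)" "\<And>y. y < x \<Longrightarrow> frechet \<alpha> y < frechet \<alpha> x"
    "\<And>y. x < y \<Longrightarrow> frechet \<alpha> x < frechet \<alpha> y"
proof (rule that[of "t powr (- (1 / \<alpha>))"])
  have x: "0 < t powr (- (1 / \<alpha>))" using assms by simp
  show "frechet \<alpha> (t powr (- (1 / \<alpha>))) = exp (- t)"
    using frechet_scale[of \<alpha> 1 t] assms by simp
  show "frechet \<alpha> y < frechet \<alpha> (t powr (- (1 / \<alpha>)))" if "y < t powr (- (1 / \<alpha>))" for y
    using assms x that by (intro frechet_less)
  show "frechet \<alpha> (t powr (- (1 / \<alpha>))) < frechet \<alpha> y" if "t powr (- (1 / \<alpha>)) < y" for y
    using assms that order.strict_trans[OF x that] by (intro frechet_less)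
qed

lemma isCont_frechet:
  assumes "0 < x"
  shows "isCont (frechet \<alpha>) x"
proof -
  have "isCont (\<lambda>x. exp (- (x powr (- \<alpha>)))) x"
    using assms by (auto intro!: continuous_intros)
  moreover have "\<forall>\<^sub>F y in nhds x. frechet \<alpha> y = exp (- (y powr (- \<alpha>)))"
    using eventually_nhds_in_open[of "{0<..}" x] assms
    by (auto elim!: eventually_mono simp: frechet_def)
  ultimately show ?thesis by (subst isCont_cong)
qed

lemma df_inverse_eqI:
  assumes "h x = u" "\<And>y. y < x \<Longrightarrow> h y < h x" "\<And>y. x < y \<Longrightarrow> h x < h y"
  shows "df_inverse h u = x"
proof -
  have "u \<le> h y \<longleftrightarrow> x \<le> y" for y
    using assms(1) assms(2)[of y] assms(3)[of y] by (cases y x rule: linorder_cases) auto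
  then have "{y. u \<le> h y} = {x..}" by auto
  then show ?thesis by (simp add: df_inverse_def)
qed

lemma extreme_value_type_inverse:
  assumes h: "h \<in> {gumbel, weibull \<alpha>, frechet \<alpha>}" and "0 < \<alpha>" "0 < t"
  shows "h (df_inverse h (exp (- t))) = exp (- t)"
    and "z < df_inverse h (exp (- t)) \<Longrightarrow> h z < exp (- t)"
    and "df_inverse h (exp (- t)) < z \<Longrightarrow> exp (- t) < h z"
proof -
  obtain x where x: "h x = exp (- t)" "\<And>z. z < x \<Longrightarrow> h z < h x" "\<And>z. x < z \<Longrightarrow> h x < h z"
    using h gumbel_inverse[OF \<open>0 < t\<close>] weibull_inverse[OF \<open>0 < t\<close> \<open>0 < \<alpha>\<close>]
      frechet_inverse[OF \<open>0 < t\<close> \<open>0 < \<alpha>\<close>] by (metis empty_iff insert_iff)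
  have "df_inverse h (exp (- t)) = x" by (rule df_inverse_eqI[of h x, OF x])
  then show "h (df_inverse h (exp (- t))) = exp (- t)"
    "z < df_inverse h (exp (- t)) \<Longrightarrow> h z < exp (- t)"
    "df_inverse h (exp (- t)) < z \<Longrightarrow> exp (- t) < h z"
    using x by simp_all
qed

section \<open>Effect of rescaling a level on the marginal tail\<close>

text \<open>
  Since \<open>h\<close> is positive everywhere and \<open>f\<close> vanishes below 0, the points \<open>a n * x + b n\<close> are
  eventually nonnegative for every \<open>x\<close>, however negative; that is, \<open>b n / a n\<close> tends to infinity.
  Dividing a level by \<open>c < 1\<close> raises its normalized position by about \<open>(1 / c - 1) * b n / a n\<close>,
  hence to infinity.
\<close>
lemma light_tail_scaled_levels:
  fixes f h :: "real \<Rightarrow> real" and a b v :: "nat \<Rightarrow> real"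
  assumes f: "mono f" "\<And>x. 0 \<le> f x" "\<And>x. f x \<le> 1" "\<And>x. x < 0 \<Longrightarrow> f x = 0"
    and a: "\<And>n. 0 < a n"
    and dom: "\<And>x. (\<lambda>n. f (a n * x + b n) ^ n) \<longlonglongrightarrow> h x"
    and hpos: "\<And>x. 0 < h x" and h1: "(h \<longlongrightarrow> 1) at_top"
    and \<xi>: "h \<xi> = exp (- t)" "\<And>y. y < \<xi> \<Longrightarrow> h y < h \<xi>" "\<And>y. \<xi> < y \<Longrightarrow> h \<xi> < h y"
    and c: "0 < c" "c < 1"
    and v: "(\<lambda>n. real n * (1 - f (v n))) \<longlonglongrightarrow> t"
  shows "(\<lambda>n. real n * (1 - f (v n / c))) \<longlonglongrightarrow> 0"
proof -
  have v': "(\<lambda>n. f (v n) ^ n) \<longlonglongrightarrow> h \<xi>"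
    unfolding \<xi>(1) by (rule tendsto_self_power_exp_iff[OF f(2,3), THEN iffD2, OF v])
  have z: "(\<lambda>n. (v n - b n) / a n) \<longlonglongrightarrow> \<xi>"
    by (rule normalized_levels_tendsto[OF f(1,2) a filterlim_ident dom v' \<xi>(2,3)])
  have \<beta>: "filterlim (\<lambda>n. b n / a n) at_top sequentially"
    unfolding filterlim_at_top
  proof
    fix Z :: real
    show "\<forall>\<^sub>F n in sequentially. Z \<le> b n / a n"
      using order_tendstoD(1)[OF dom hpos, of "- Z"] eventually_gt_at_top[of 0]
    proof eventually_elim
      case (elim n)
      then have "\<not> a n * (- Z) + b n < 0" using f(4) by (auto simp: power_0_left)
      then show ?case using a[of n] by (simp add: pos_le_divide_eq algebra_simps)
    qed
  qed
  have "filterlim (\<lambda>n. (1 / c - 1) * (b n / a n)) at_top sequentially"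
    using c by (intro filterlim_tendsto_pos_mult_at_top[OF tendsto_const _ \<beta>]) (simp add: field_simps)
  from filterlim_tendsto_add_at_top[OF tendsto_mult[OF tendsto_const[of "1 / c"] z] this]
  have "filterlim (\<lambda>n. (v n / c - b n) / a n) at_top sequentially"
  proof (rule filterlim_cong[THEN iffD1, rotated -1], goal_cases)
    case 3
    show ?case
    proof (rule always_eventually, rule allI)
      fix n
      show "1 / c * ((v n - b n) / a n) + (1 / c - 1) * (b n / a n) = (v n / c - b n) / a n"
        using c a[of n] by (simp add: field_simps)
    qed
  qed simp_all
  from domain_power_tendsto_1[OF f(1-3) a dom this h1]
  have "(\<lambda>n. f (v n / c) ^ n) \<longlonglongrightarrow> exp (- 0)" by simp
  then show ?thesis by (rule tendsto_self_power_exp_iff[OF f(2,3), THEN iffD1])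
qed

text \<open>
  Using the constants of index \<open>m\<close> with the power \<open>m div 2\<close> halves the limiting tail, which for the Frechet
  law amounts to a dilation by \<open>\<kappa> = 2 powr (1 / \<alpha>) > 1\<close> without translation. Convergence of types then
  gives \<open>a m \<sim> \<kappa> * a (m div 2)\<close> and a difference \<open>b m - b (m div 2)\<close> of smaller order than
  \<open>a (m div 2)\<close>, so the ratios \<open>b m / a m\<close> obey a contracting recursion.
\<close>
lemma frechet_domain_centering_negligible:
  fixes f :: "real \<Rightarrow> real" and a b :: "nat \<Rightarrow> real"
  assumes f: "mono f" "\<And>x. 0 \<le> f x" "\<And>x. f x \<le> 1" and a: "\<And>n. 0 < a n"
    and dom: "\<And>x. (\<lambda>n. f (a n * x + b n) ^ n) \<longlonglongrightarrow> frechet \<alpha> x" and \<alpha>: "0 < \<alpha>"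
  shows "(\<lambda>n. b n / a n) \<longlonglongrightarrow> 0"
proof -
  define \<kappa> where "\<kappa> = (1 / 2) powr (- (1 / \<alpha>))"
  have "1 powr (- (1 / \<alpha>)) < (1 / 2) powr (- (1 / \<alpha>))"
    using \<alpha> by (intro powr_less_mono2_neg) auto
  then have \<kappa>1: "1 < \<kappa>" by (simp only: \<kappa>_def powr_one_eq_one)
  have half: "filterlim (\<lambda>m::nat. m div 2) at_top sequentially"
    by (rule filterlim_at_top_div_const_nat) simp
  have halfr: "(\<lambda>m. real (m div 2) / real m) \<longlonglongrightarrow> 1 / 2"
  proof (rule tendsto_sandwich)
    show "\<forall>\<^sub>F m in sequentially. 1 / 2 - 1 / real m \<le> real (m div 2) / real m"
      using eventually_gt_at_top[of 0]
    proof eventually_elim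
      case (elim m)
      have "real m / 2 - 1 \<le> real (m div 2)" by linarith
      from divide_right_mono[OF this, of "real m"] show ?case
        using elim by (simp add: diff_divide_distrib)
    qed
    show "\<forall>\<^sub>F m in sequentially. real (m div 2) / real m \<le> 1 / 2"
      using eventually_gt_at_top[of 0]
    proof eventually_elim
      case (elim m)
      have "2 * real (m div 2) \<le> real m" by linarith
      then show ?case using elim by (simp add: field_simps)
    qed
    show "(\<lambda>m. 1 / 2 - 1 / real m) \<longlonglongrightarrow> 1 / 2"
      using tendsto_diff[OF tendsto_const[of "1/2"] lim_1_over_n] by simp
  qed simp
  \<comment> \<open>two values of \<open>x\<close> suffice to separate scale and location\<close>
  have types: "(\<lambda>m. (a m * x + b m - b (m div 2)) / a (m div 2)) \<longlonglongrightarrow> \<kappa> * x" if x: "0 < x" for x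
  proof (rule normalized_levels_tendsto[OF f(1,2) a half dom])
    have "(\<lambda>m. real m * (1 - f (a m * x + b m))) \<longlonglongrightarrow> x powr (- \<alpha>)"
      using dom[of x] x
      by (intro tendsto_self_power_exp_iff[OF f(2,3), THEN iffD1]) (simp add: frechet_def)
    from tendsto_mult[OF halfr this]
    have "(\<lambda>m. real (m div 2) * (1 - f (a m * x + b m))) \<longlonglongrightarrow> 1 / 2 * x powr (- \<alpha>)"
      by (rule Lim_transform_eventually)
        (use eventually_gt_at_top[of 0] in eventually_elim, simp)
    then have "(\<lambda>m. f (a m * x + b m) ^ (m div 2)) \<longlonglongrightarrow> exp (- (1 / 2 * x powr (- \<alpha>)))"
      by (rule tendsto_power_exp_iff[OF half f(2,3), THEN iffD2])
    also have "exp (- (1 / 2 * x powr (- \<alpha>))) = frechet \<alpha> (\<kappa> * x)"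
      unfolding \<kappa>_def using frechet_scale[OF \<alpha> x, of "1 / 2"] by simp
    finally show "(\<lambda>m. f (a m * x + b m) ^ (m div 2)) \<longlonglongrightarrow> frechet \<alpha> (\<kappa> * x)" .
    show "frechet \<alpha> y < frechet \<alpha> (\<kappa> * x)" if "y < \<kappa> * x" for y
      using \<alpha> that \<kappa>1 x by (intro frechet_less) auto
    show "frechet \<alpha> (\<kappa> * x) < frechet \<alpha> y" if "\<kappa> * x < y" for y
    proof -
      have "0 < \<kappa> * x" using \<kappa>1 x by simp
      then show ?thesis using \<alpha> that by (intro frechet_less) auto
    qed
  qed
  have "(a m * 2 + b m - b (m div 2)) / a (m div 2) - (a m * 1 + b m - b (m div 2)) / a (m div 2)
      = a m / a (m div 2)" for m
    by (simp add: diff_divide_distrib add_divide_distrib)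
  then have ratio: "(\<lambda>m. a m / a (m div 2)) \<longlonglongrightarrow> \<kappa>"
    using tendsto_diff[OF types[of 2] types[of 1]] by simp
  have "(a m * 1 + b m - b (m div 2)) / a (m div 2) - a m / a (m div 2)
      = (b m - b (m div 2)) / a (m div 2)" for m
    by (simp add: diff_divide_distrib add_divide_distrib)
  then have shift: "(\<lambda>m. (b m - b (m div 2)) / a (m div 2)) \<longlonglongrightarrow> 0"
    using tendsto_diff[OF types[of 1] ratio] by simp
  show ?thesis
  proof (rule halving_recursion_tendsto_0)
    show "b m / a m = a (m div 2) / a m * (b (m div 2) / a (m div 2))
        + (b m - b (m div 2)) / a (m div 2) / (a m / a (m div 2))" for m
      using a[of m] a[of "m div 2"] by (simp add: field_simps)
    show "(\<lambda>m. a (m div 2) / a m) \<longlonglongrightarrow> inverse \<kappa>"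
      using tendsto_inverse[OF ratio] \<kappa>1 by (simp add: inverse_eq_divide)
    show "\<bar>inverse \<kappa>\<bar> < 1" using \<kappa>1 by (simp add: field_simps)
    show "(\<lambda>m. (b m - b (m div 2)) / a (m div 2) / (a m / a (m div 2))) \<longlonglongrightarrow> 0"
      using tendsto_divide[OF shift ratio] \<kappa>1 by simp
  qed
qed

text \<open>
  As the centering is negligible, dividing a level by \<open>c\<close> divides its normalized position by \<open>c\<close>
  in the limit.
\<close>
lemma frechet_tail_scaled_levels:
  fixes f :: "real \<Rightarrow> real" and a b v :: "nat \<Rightarrow> real"
  assumes f: "mono f" "\<And>x. 0 \<le> f x" "\<And>x. f x \<le> 1" and a: "\<And>n. 0 < a n"
    and dom: "\<And>x. (\<lambda>n. f (a n * x + b n) ^ n) \<longlonglongrightarrow> frechet \<alpha> x" and \<alpha>: "0 < \<alpha>"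
    and c: "0 < c" and t: "0 < t"
    and v: "(\<lambda>n. real n * (1 - f (v n))) \<longlonglongrightarrow> t"
  shows "(\<lambda>n. real n * (1 - f (v n / c))) \<longlonglongrightarrow> t * c powr \<alpha>"
proof -
  define x0 where "x0 = t powr (- (1 / \<alpha>))"
  have x0: "0 < x0" using t by (simp add: x0_def)
  have h: "frechet \<alpha> x0 = exp (- t)" using frechet_scale[OF \<alpha> _ t, of 1] by (simp add: x0_def)
  have v': "(\<lambda>n. f (v n) ^ n) \<longlonglongrightarrow> frechet \<alpha> x0"
    unfolding h by (rule tendsto_self_power_exp_iff[OF f(2,3), THEN iffD2, OF v])
  have z: "(\<lambda>n. (v n - b n) / a n) \<longlonglongrightarrow> x0"
    by (rule normalized_levels_tendsto[OF f(1,2) a filterlim_ident dom v'])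
      (use x0 frechet_less[OF \<alpha>] in auto)
  have \<beta>: "(\<lambda>n. b n / a n) \<longlonglongrightarrow> 0"
    by (rule frechet_domain_centering_negligible[OF f a dom \<alpha>])
  have "(\<lambda>n. (v n / c - b n) / a n) = (\<lambda>n. 1 / c * ((v n - b n) / a n) + (1 / c - 1) * (b n / a n))"
  proof
    fix n
    show "(v n / c - b n) / a n = 1 / c * ((v n - b n) / a n) + (1 / c - 1) * (b n / a n)"
      using c a[of n] by (simp add: field_simps)
  qed
  then have "(\<lambda>n. (v n / c - b n) / a n) \<longlonglongrightarrow> x0 * (1 / c)"
    using tendsto_add[OF tendsto_mult[OF tendsto_const[of "1 / c"] z]
        tendsto_mult[OF tendsto_const[of "1 / c - 1"] \<beta>]]
    by simp
  from domain_power_tendsto[OF f(1,2) a dom this isCont_frechet]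
  have "(\<lambda>n. f (v n / c) ^ n) \<longlonglongrightarrow> frechet \<alpha> (x0 * (1 / c))"
    using x0 c by simp
  also have "frechet \<alpha> (x0 * (1 / c)) = exp (- (t * (1 / c) powr (- \<alpha>)))"
    unfolding x0_def using c by (intro frechet_scale[OF \<alpha> _ t]) simp
  also have "(1 / c) powr (- \<alpha>) = c powr \<alpha>"
    using c by (simp add: powr_divide powr_minus_divide)
  finally show ?thesis
    by (rule tendsto_self_power_exp_iff[OF f(2,3), THEN iffD1])
qed

section \<open>Marginal distribution functions\<close>

definition lower_orthant :: "'d set \<Rightarrow> real ^ 'd \<Rightarrow> (real ^ 'd) set"
  where "lower_orthant I x = {y. \<forall>j\<in>I. y $ j \<le> x $ j}"

lemma lower_orthant_borel [measurable]: "lower_orthant I x \<in> sets borel"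
proof -
  have "lower_orthant I x = (\<Inter>j\<in>I. {y. y $ j \<le> x $ j})" by (auto simp: lower_orthant_def)
  then have "closed (lower_orthant I x)"
    by (simp add: closed_INT closed_halfspace_component_le_cart)
  then show ?thesis by simp
qed

lemma measurable_vec_nth_borel [measurable]: "(\<lambda>y :: real ^ 'd. y $ j) \<in> borel_measurable borel"
  by (intro borel_measurable_continuous_onI continuous_on_component continuous_on_id)

lemma marginal_df_eq_measure: "marginal_df N I x = measure N (lower_orthant I x)"
  by (simp add: marginal_df_def lower_orthant_def)

lemma joint_df_eq_marginal_df: "joint_df N x = marginal_df N UNIV x"
  by (simp add: joint_df_def marginal_df_def less_eq_vec_def atMost_def)

locale multivariate_distribution = prob_space N for N :: "(real ^ 'd) measure" +
  assumes sets_eq_borel: "sets N = sets borel"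
begin

lemma lower_orthant_events [simp]: "lower_orthant I x \<in> events"
  by (simp add: sets_eq_borel lower_orthant_borel)

lemma space_eq_UNIV [simp]: "space N = UNIV"
  using sets_eq_imp_space_eq[OF sets_eq_borel] by simp

lemma marginal_df_nonneg: "0 \<le> marginal_df N I x"
  by (simp add: marginal_df_def)

lemma marginal_df_le_1: "marginal_df N I x \<le> 1"
  by (simp add: marginal_df_def)

lemma marginal_df_empty: "marginal_df N {} x = 1"
  using prob_space by (simp add: marginal_df_def)

lemma real_distribution_component: "real_distribution (distr N borel (\<lambda>y. y $ j))"
  by (rule real_distribution_distr)
    (simp add: measurable_cong_sets[OF sets_eq_borel refl])

lemma margin_eq_measure: "margin N j t = prob {y. y $ j \<le> t}"
proof -
  have "(\<lambda>y. y $ j) \<in> N \<rightarrow>\<^sub>M borel"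
    by (simp add: measurable_cong_sets[OF sets_eq_borel refl])
  then show ?thesis
    by (simp add: margin_def cdf_def measure_distr vimage_def)
qed

lemma margin_eq_marginal_df: "margin N j t = marginal_df N {j} (\<chi> i. t)"
  by (simp add: margin_eq_measure marginal_df_def)

lemma mono_margin: "mono (margin N j)"
proof -
  interpret D: real_distribution "distr N borel (\<lambda>y. y $ j)" by (rule real_distribution_component)
  show ?thesis unfolding margin_def by (auto intro: monoI D.cdf_nondecreasing)
qed

lemma margin_nonneg: "0 \<le> margin N j t" and margin_le_1: "margin N j t \<le> 1"
  by (simp_all add: margin_eq_measure)

lemma margin_at_top: "(margin N j \<longlongrightarrow> 1) at_top" and margin_at_bot: "(margin N j \<longlongrightarrow> 0) at_bot"
proof -
  interpret D: real_distribution "distr N borel (\<lambda>y. y $ j)" by (rule real_distribution_component)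
  show "(margin N j \<longlongrightarrow> 1) at_top" "(margin N j \<longlongrightarrow> 0) at_bot"
    unfolding margin_def by (rule D.cdf_lim_at_top_prob, rule D.cdf_lim_at_bot)
qed

lemma prob_component_greater: "prob {y. t < y $ j} = 1 - margin N j t"
proof -
  have "{y. y $ j \<le> t} = lower_orthant {j} (\<chi> i. t)" by (simp add: lower_orthant_def)
  then have "{y. y $ j \<le> t} \<in> events" by simp
  from prob_compl[OF this] show ?thesis
    by (simp add: margin_eq_measure Compl_eq_Diff_UNIV[symmetric] Collect_neg_eq[symmetric] not_le)
qed

lemma marginal_df_anti_mono_index: "I \<subseteq> J \<Longrightarrow> marginal_df N J x \<le> marginal_df N I x"
  unfolding marginal_df_eq_measure
  by (intro finite_measure_mono lower_orthant_events) (auto simp: lower_orthant_def)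

lemma marginal_df_mono: "(\<And>j. j \<in> I \<Longrightarrow> x $ j \<le> y $ j) \<Longrightarrow> marginal_df N I x \<le> marginal_df N I y"
  unfolding marginal_df_eq_measure
  by (intro finite_measure_mono lower_orthant_events) (force simp: lower_orthant_def)

lemma marginal_df_le_margin: "j \<in> I \<Longrightarrow> marginal_df N I x \<le> margin N j (x $ j)"
  using marginal_df_anti_mono_index[of "{j}" I x]
  by (simp add: margin_eq_marginal_df marginal_df_def)

lemma component_strip_events: "{y. s < y $ j \<and> y $ j \<le> t} \<in> events"
proof -
  have "{y. s < y $ j \<and> y $ j \<le> t} = lower_orthant {j} (\<chi> i. t) - lower_orthant {j} (\<chi> i. s)"
    by (auto simp: lower_orthant_def)
  then show ?thesis by (simp add: sets.Diff)
qed

lemma prob_component_strip_le: "prob {y. s < y $ j \<and> y $ j \<le> t} \<le> \<bar>margin N j t - margin N j s\<bar>"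
proof (cases "s \<le> t")
  case True
  have "{y. s < y $ j \<and> y $ j \<le> t} = lower_orthant {j} (\<chi> i. t) - lower_orthant {j} (\<chi> i. s)"
    by (auto simp: lower_orthant_def)
  moreover have "lower_orthant {j} (\<chi> i. s) \<subseteq> lower_orthant {j} (\<chi> i. t)"
    using True by (auto simp: lower_orthant_def)
  ultimately show ?thesis
    by (simp add: finite_measure_Diff margin_eq_marginal_df marginal_df_eq_measure)
next
  case False
  then have "{y. s < y $ j \<and> y $ j \<le> t} = {}" by auto
  then show ?thesis by (simp only: measure_empty abs_ge_zero)
qed

text \<open>
  A point in exactly one of the two orthants has some coordinate between the two levels.
\<close>
lemma marginal_df_diff_le:
  "\<bar>marginal_df N I x - marginal_df N I y\<bar> \<le> (\<Sum>j\<in>I. \<bar>margin N j (x $ j) - margin N j (y $ j)\<bar>)"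
proof -
  have one_sided: "marginal_df N I x - marginal_df N I y
      \<le> (\<Sum>j\<in>I. \<bar>margin N j (x $ j) - margin N j (y $ j)\<bar>)" for x y
  proof -
    let ?S = "\<lambda>j. {w. y $ j < w $ j \<and> w $ j \<le> x $ j}"
    have "lower_orthant I x \<subseteq> lower_orthant I y \<union> (\<Union>j\<in>I. ?S j)"
      by (auto simp: lower_orthant_def not_le)
    then have "prob (lower_orthant I x) \<le> prob (lower_orthant I y \<union> (\<Union>j\<in>I. ?S j))"
      by (intro finite_measure_mono sets.Un sets.finite_UN component_strip_events) auto
    also have "\<dots> \<le> prob (lower_orthant I y) + prob (\<Union>j\<in>I. ?S j)"
      by (intro measure_Un_le sets.finite_UN component_strip_events) auto
    also have "prob (\<Union>j\<in>I. ?S j) \<le> (\<Sum>j\<in>I. prob (?S j))"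
      by (intro measure_UNION_le) (auto intro: component_strip_events)
    also have "\<dots> \<le> (\<Sum>j\<in>I. \<bar>margin N j (x $ j) - margin N j (y $ j)\<bar>)"
      by (intro sum_mono prob_component_strip_le)
    finally show ?thesis by (simp add: marginal_df_eq_measure)
  qed
  from one_sided[of x y] one_sided[of y x] show ?thesis
    by (simp add: abs_le_iff abs_minus_commute)
qed

lemma marginal_df_drop_indices_le:
  "marginal_df N I x - marginal_df N J x \<le> (\<Sum>j\<in>J - I. 1 - margin N j (x $ j))"
proof -
  let ?S = "\<lambda>j. {w. x $ j < w $ j}"
  have S: "?S j \<in> events" for j
  proof -
    have "?S j = UNIV - lower_orthant {j} x" by (auto simp: lower_orthant_def)
    then show ?thesis using sets.compl_sets[of "lower_orthant {j} x" N] by simp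
  qed
  have "lower_orthant I x \<subseteq> lower_orthant J x \<union> (\<Union>j\<in>J - I. ?S j)"
    by (auto simp: lower_orthant_def not_le)
  then have "prob (lower_orthant I x) \<le> prob (lower_orthant J x \<union> (\<Union>j\<in>J - I. ?S j))"
    by (intro finite_measure_mono sets.Un sets.finite_UN S) auto
  also have "\<dots> \<le> prob (lower_orthant J x) + prob (\<Union>j\<in>J - I. ?S j)"
    by (intro measure_Un_le sets.finite_UN S) auto
  also have "prob (\<Union>j\<in>J - I. ?S j) \<le> (\<Sum>j\<in>J - I. prob (?S j))"
    by (intro measure_UNION_le) (auto intro: S)
  finally show ?thesis by (simp add: marginal_df_eq_measure prob_component_greater)
qed

lemma one_minus_marginal_df_le: "1 - marginal_df N I x \<le> (\<Sum>j\<in>I. 1 - margin N j (x $ j))"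
  using marginal_df_drop_indices_le[of "{}" x I] by (simp add: marginal_df_empty)

text \<open>
  Adding constraints on the coordinates outside \<open>I\<close>. The error is a single probability instead of a sum over
  coordinates, as \<open>power_diff_le_one_minus_power\<close> requires for passing to \<open>n\<close>-th powers.
\<close>
lemma marginal_df_diff_le_one_minus:
  assumes "\<And>j. j \<in> I \<Longrightarrow> y $ j = x $ j" and "\<And>j. j \<notin> I \<Longrightarrow> z $ j \<le> y $ j"
  shows "marginal_df N I x - marginal_df N UNIV y \<le> 1 - marginal_df N UNIV z"
proof -
  have "lower_orthant I x \<subseteq> lower_orthant UNIV y \<union> (UNIV - lower_orthant UNIV z)"
  proof
    fix w assume "w \<in> lower_orthant I x"
    then show "w \<in> lower_orthant UNIV y \<union> (UNIV - lower_orthant UNIV z)"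
      using assms by (simp add: lower_orthant_def) (metis order_trans)
  qed
  then have "prob (lower_orthant I x) \<le> prob (lower_orthant UNIV y \<union> (UNIV - lower_orthant UNIV z))"
    using sets.compl_sets[of "lower_orthant UNIV z" N]
    by (intro finite_measure_mono sets.Un) auto
  also have "\<dots> \<le> prob (lower_orthant UNIV y) + prob (UNIV - lower_orthant UNIV z)"
    using sets.compl_sets[of "lower_orthant UNIV z" N]
    by (intro measure_Un_le) auto
  finally show ?thesis
    using prob_compl[of "lower_orthant UNIV z"] by (simp add: marginal_df_eq_measure)
qed

lemma sum_margin_tail_at_top:
  "((\<lambda>t. \<Sum>j\<in>I. 1 - margin N j t) \<longlongrightarrow> 0) at_top"
  using tendsto_sum[of I "\<lambda>j t. 1 - margin N j t" "\<lambda>_. 0" at_top]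
    tendsto_diff[OF tendsto_const[of 1] margin_at_top]
  by simp

lemma marginal_df_tail_extend:
  assumes "I \<subseteq> J"
    and I: "(\<lambda>n. real n * (1 - marginal_df N I (u n))) \<longlonglongrightarrow> A"
    and negl: "\<And>j. j \<in> J - I \<Longrightarrow> (\<lambda>n. real n * (1 - margin N j (u n $ j))) \<longlonglongrightarrow> 0"
  shows "(\<lambda>n. real n * (1 - marginal_df N J (u n))) \<longlonglongrightarrow> A"
proof (rule tendsto_sandwich)
  show "\<forall>\<^sub>F n in sequentially. real n * (1 - marginal_df N I (u n)) \<le> real n * (1 - marginal_df N J (u n))"
    using marginal_df_anti_mono_index[OF assms(1)]
    by (intro always_eventually allI mult_left_mono) simp_all
  show "\<forall>\<^sub>F n in sequentially. real n * (1 - marginal_df N J (u n))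
      \<le> real n * (1 - marginal_df N I (u n)) + (\<Sum>j\<in>J - I. real n * (1 - margin N j (u n $ j)))"
    unfolding sum_distrib_left[symmetric] distrib_left[symmetric]
  proof (intro always_eventually allI mult_left_mono)
    fix n
    show "1 - marginal_df N J (u n) \<le> 1 - marginal_df N I (u n) + (\<Sum>j\<in>J - I. 1 - margin N j (u n $ j))"
      using marginal_df_drop_indices_le[of I "u n" J] by linarith
  qed simp
  have "(\<lambda>n. real n * (1 - marginal_df N I (u n)) + (\<Sum>j\<in>J - I. real n * (1 - margin N j (u n $ j))))
      \<longlonglongrightarrow> A + (\<Sum>j\<in>J - I. 0)"
    by (intro tendsto_add I tendsto_sum negl)
  then show "(\<lambda>n. real n * (1 - marginal_df N I (u n)) + (\<Sum>j\<in>J - I. real n * (1 - margin N j (u n $ j))))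
      \<longlonglongrightarrow> A" by simp
qed (rule I)

end

section \<open>Multivariate domains of attraction\<close>

locale max_domain = F: multivariate_distribution F + H: multivariate_distribution H
  for F H :: "(real ^ 'd) measure" +
  fixes a b :: "nat \<Rightarrow> real ^ 'd"
  assumes a_pos: "0 < a n $ j"
    and joint_df_power_tendsto:
      "(\<lambda>n. joint_df F (\<chi> j. a n $ j * x $ j + b n $ j) ^ n) \<longlonglongrightarrow> joint_df H x"
begin

text \<open>
  Joint convergence is given at points with finite coordinates only. The coordinates outside \<open>I\<close>
  are set to \<open>t\<close>; the error is at most \<open>1 - H(z)\<close> in the limit, and this is small for large \<open>t\<close>.
\<close>
lemma marginal_df_power_tendsto:
  "(\<lambda>n. marginal_df F I (\<chi> j. a n $ j * x $ j + b n $ j) ^ n) \<longlonglongrightarrow> marginal_df H I x"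
proof -
  define lev where "lev n y = (\<chi> j. a n $ j * y $ j + b n $ j)" for n and y :: "real ^ 'd"
  define y where "y t = (\<chi> j. if j \<in> I then x $ j else t)" for t
  \<comment> \<open>\<open>z t\<close> dominates \<open>y t\<close> and tends to infinity in all coordinates\<close>
  define z where "z t = (\<chi> j. if j \<in> I then max (x $ j) t else t)" for t
  have joint: "(\<lambda>n. marginal_df F UNIV (lev n v) ^ n) \<longlonglongrightarrow> marginal_df H UNIV v" for v
    using joint_df_power_tendsto[of v] by (simp add: joint_df_eq_marginal_df lev_def)
  have lev_mono: "lev n v $ j \<le> lev n w $ j" if "v $ j \<le> w $ j" for n v w j
    using that a_pos[of n j] by (simp add: lev_def)
  have lower: "marginal_df F UNIV (lev n (y t)) \<le> marginal_df F I (lev n x)" for n t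
  proof -
    have "marginal_df F UNIV (lev n (y t)) \<le> marginal_df F I (lev n (y t))"
      by (rule F.marginal_df_anti_mono_index) simp
    also have "\<dots> = marginal_df F I (lev n x)"
      by (auto simp: marginal_df_def lev_def y_def intro!: arg_cong[of _ _ "measure F"])
    finally show ?thesis .
  qed
  have upper: "marginal_df F I (lev n x) ^ n
      \<le> marginal_df F UNIV (lev n (y t)) ^ n + (1 - marginal_df F UNIV (lev n (z t)) ^ n)" for n t
  proof -
    have "marginal_df F I (lev n x) ^ n - marginal_df F UNIV (lev n (y t)) ^ n
        \<le> 1 - marginal_df F UNIV (lev n (z t)) ^ n"
    proof (rule power_diff_le_one_minus_power)
      show "marginal_df F UNIV (lev n (y t)) \<le> marginal_df F UNIV (lev n (z t))"
        by (intro F.marginal_df_mono lev_mono) (simp add: y_def z_def)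
      show "marginal_df F I (lev n x) - marginal_df F UNIV (lev n (y t))
          \<le> 1 - marginal_df F UNIV (lev n (z t))"
        by (rule F.marginal_df_diff_le_one_minus) (simp_all add: lev_def y_def z_def)
    qed (simp_all add: F.marginal_df_nonneg F.marginal_df_le_1 lower)
    then show ?thesis by linarith
  qed
  have Hy: "((\<lambda>t. marginal_df H UNIV (y t)) \<longlongrightarrow> marginal_df H I x) at_top"
  proof (rule tendsto_sandwich)
    have eq: "marginal_df H I (y t) = marginal_df H I x" for t
      by (auto simp: marginal_df_def y_def intro!: arg_cong[of _ _ "measure H"])
    show "\<forall>\<^sub>F t in at_top. marginal_df H I x - (\<Sum>j\<in>UNIV - I. 1 - margin H j t)
        \<le> marginal_df H UNIV (y t)"
    proof (rule always_eventually, rule allI)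
      fix t
      have "(\<Sum>j\<in>UNIV - I. 1 - margin H j (y t $ j)) = (\<Sum>j\<in>UNIV - I. 1 - margin H j t)"
        by (rule sum.cong) (simp_all add: y_def)
      then show "marginal_df H I x - (\<Sum>j\<in>UNIV - I. 1 - margin H j t) \<le> marginal_df H UNIV (y t)"
        using H.marginal_df_drop_indices_le[of I "y t" UNIV] eq[of t] by linarith
    qed
    show "\<forall>\<^sub>F t in at_top. marginal_df H UNIV (y t) \<le> marginal_df H I x"
      using H.marginal_df_anti_mono_index[of I UNIV "y _"] by (simp add: eq)
    show "((\<lambda>t. marginal_df H I x - (\<Sum>j\<in>UNIV - I. 1 - margin H j t)) \<longlongrightarrow> marginal_df H I x) at_top"
      using tendsto_diff[OF tendsto_const[of "marginal_df H I x"] H.sum_margin_tail_at_top] by simp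
  qed simp
  have Hz: "((\<lambda>t. marginal_df H UNIV (z t)) \<longlongrightarrow> 1) at_top"
  proof (rule tendsto_sandwich)
    show "\<forall>\<^sub>F t in at_top. 1 - (\<Sum>j\<in>UNIV. 1 - margin H j t) \<le> marginal_df H UNIV (z t)"
    proof (rule always_eventually, rule allI)
      fix t
      have "(\<Sum>j\<in>UNIV. 1 - margin H j (z t $ j)) \<le> (\<Sum>j\<in>UNIV. 1 - margin H j t)"
        by (intro sum_mono diff_left_mono monoD[OF H.mono_margin]) (simp add: z_def)
      then show "1 - (\<Sum>j\<in>UNIV. 1 - margin H j t) \<le> marginal_df H UNIV (z t)"
        using H.one_minus_marginal_df_le[of UNIV "z t"] by linarith
    qed
    show "\<forall>\<^sub>F t in at_top. marginal_df H UNIV (z t) \<le> 1"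
      by (simp add: H.marginal_df_le_1)
    show "((\<lambda>t. 1 - (\<Sum>j\<in>UNIV. 1 - margin H j t)) \<longlongrightarrow> 1) at_top"
      using tendsto_diff[OF tendsto_const[of 1] H.sum_margin_tail_at_top] by simp
  qed simp
  show ?thesis
    unfolding lev_def[symmetric]
  proof (rule order_tendstoI)
    fix r assume "r < marginal_df H I x"
    from order_tendstoD(1)[OF Hy this] obtain t where "r < marginal_df H UNIV (y t)"
      by (auto simp: eventually_at_top_linorder)
    from order_tendstoD(1)[OF joint this]
    show "\<forall>\<^sub>F n in sequentially. r < marginal_df F I (lev n x) ^ n"
      by eventually_elim
        (meson lower power_mono F.marginal_df_nonneg less_le_trans)
  next
    fix r assume r: "marginal_df H I x < r"
    have "((\<lambda>t. marginal_df H UNIV (y t) + (1 - marginal_df H UNIV (z t)))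
        \<longlongrightarrow> marginal_df H I x + (1 - 1)) at_top"
      by (intro tendsto_intros Hy Hz)
    from order_tendstoD(2)[OF this, of r] r
    obtain t where t: "marginal_df H UNIV (y t) + (1 - marginal_df H UNIV (z t)) < r"
      by (auto simp: eventually_at_top_linorder)
    have "(\<lambda>n. marginal_df F UNIV (lev n (y t)) ^ n + (1 - marginal_df F UNIV (lev n (z t)) ^ n))
        \<longlonglongrightarrow> marginal_df H UNIV (y t) + (1 - marginal_df H UNIV (z t))"
      by (intro tendsto_intros joint)
    from order_tendstoD(2)[OF this t]
    show "\<forall>\<^sub>F n in sequentially. marginal_df F I (lev n x) ^ n < r"
      by eventually_elim (rule le_less_trans[OF upper])
  qed
qed

lemma margin_power_tendsto: "(\<lambda>n. margin F j (a n $ j * s + b n $ j) ^ n) \<longlonglongrightarrow> margin H j s"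
proof -
  have "marginal_df F {j} (\<chi> i. a n $ i * (\<chi> i. s) $ i + b n $ i) = margin F j (a n $ j * s + b n $ j)" for n
    by (simp add: F.margin_eq_measure marginal_df_def)
  then show ?thesis
    using marginal_df_power_tendsto[of "{j}" "\<chi> i. s"] by (simp add: H.margin_eq_marginal_df)
qed

text \<open>
  Only the limits of the marginal tails enter: by the Lipschitz bound, \<open>u\<close> may be replaced with the
  levels \<open>a n * y + b n\<close>, whose margins have the same tail limits. For these the domain of attraction
  gives the limit of the powers, and the union bound on the complement keeps that limit away from 0,
  so that its logarithm is meaningful.
\<close>
lemma marginal_df_tail_tendsto:
  fixes u :: "nat \<Rightarrow> real ^ 'd" and y :: "real ^ 'd" and t :: "'d \<Rightarrow> real"
  assumes u: "\<And>j. j \<in> I \<Longrightarrow> (\<lambda>n. real n * (1 - margin F j (u n $ j))) \<longlonglongrightarrow> t j"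
    and y: "\<And>j. j \<in> I \<Longrightarrow> margin H j (y $ j) = exp (- t j)"
  shows "0 < marginal_df H I y"
    and "(\<lambda>n. real n * (1 - marginal_df F I (u n))) \<longlonglongrightarrow> - ln (marginal_df H I y)"
proof -
  define v where "v n = (\<chi> j. a n $ j * y $ j + b n $ j)" for n
  have v: "(\<lambda>n. real n * (1 - margin F j (v n $ j))) \<longlonglongrightarrow> t j" if "j \<in> I" for j
    using margin_power_tendsto[of j "y $ j"] y[OF that]
    by (intro tendsto_self_power_exp_iff[THEN iffD1])
      (simp_all add: F.margin_nonneg F.margin_le_1 v_def)
  have dom: "(\<lambda>n. marginal_df F I (v n) ^ n) \<longlonglongrightarrow> marginal_df H I y"
    unfolding v_def by (rule marginal_df_power_tendsto)
  \<comment> \<open>\<open>1 - s n\<close> bounds the marginal distribution function at \<open>v n\<close> from below; its positive part is the base of a power\<close>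
  define s where "s n = (\<Sum>j\<in>I. 1 - margin F j (v n $ j))" for n
  have s_nonneg: "0 \<le> s n" for n
    by (simp add: s_def sum_nonneg F.margin_le_1)
  have ns: "(\<lambda>n. real n * s n) \<longlonglongrightarrow> (\<Sum>j\<in>I. t j)"
    unfolding s_def sum_distrib_left by (intro tendsto_sum v)
  have "(\<lambda>n. real n * s n / real n) \<longlonglongrightarrow> 0"
    by (rule real_tendsto_divide_at_top[OF ns filterlim_real_sequentially])
  then have "s \<longlonglongrightarrow> 0"
    by (rule Lim_transform_eventually)
      (use eventually_gt_at_top[of 0] in eventually_elim, simp)
  then have "\<forall>\<^sub>F n in sequentially. s n < 1"
    by (rule order_tendstoD) simp
  then have "(\<lambda>n. real n * (1 - max 0 (1 - s n))) \<longlonglongrightarrow> (\<Sum>j\<in>I. t j)"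
    by (intro Lim_transform_eventually[OF ns]) (auto elim!: eventually_mono)
  then have "(\<lambda>n. max 0 (1 - s n) ^ n) \<longlonglongrightarrow> exp (- (\<Sum>j\<in>I. t j))"
    by (intro tendsto_self_power_exp_iff[THEN iffD2]) (simp_all add: s_nonneg)
  moreover have "max 0 (1 - s n) ^ n \<le> marginal_df F I (v n) ^ n" for n
    using F.one_minus_marginal_df_le[of I "v n"] F.marginal_df_nonneg[of I "v n"]
    by (intro power_mono) (auto simp: s_def)
  ultimately have "exp (- (\<Sum>j\<in>I. t j)) \<le> marginal_df H I y"
    using dom by (intro LIMSEQ_le) auto
  then show pos: "0 < marginal_df H I y"
    by (meson exp_gt_zero less_le_trans)
  have lim_v: "(\<lambda>n. real n * (1 - marginal_df F I (v n))) \<longlonglongrightarrow> - ln (marginal_df H I y)"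
    using dom pos
    by (intro tendsto_self_power_exp_iff[THEN iffD1])
      (simp_all add: F.marginal_df_nonneg F.marginal_df_le_1)
  have "(\<lambda>n. real n * (marginal_df F I (u n) - marginal_df F I (v n))) \<longlonglongrightarrow> 0"
  proof (rule Lim_null_comparison)
    show "\<forall>\<^sub>F n in sequentially. norm (real n * (marginal_df F I (u n) - marginal_df F I (v n)))
        \<le> (\<Sum>j\<in>I. \<bar>real n * (1 - margin F j (v n $ j)) - real n * (1 - margin F j (u n $ j))\<bar>)"
    proof (rule always_eventually, rule allI)
      fix n
      have "real n * \<bar>marginal_df F I (u n) - marginal_df F I (v n)\<bar>
          \<le> real n * (\<Sum>j\<in>I. \<bar>margin F j (u n $ j) - margin F j (v n $ j)\<bar>)"
        by (intro mult_left_mono F.marginal_df_diff_le) simp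
      also have "\<dots> = (\<Sum>j\<in>I. \<bar>real n * (1 - margin F j (v n $ j)) - real n * (1 - margin F j (u n $ j))\<bar>)"
        unfolding sum_distrib_left right_diff_distrib[symmetric] by (simp add: abs_mult)
      finally show "norm (real n * (marginal_df F I (u n) - marginal_df F I (v n))) \<le> \<dots>"
        by (simp add: abs_mult)
    qed
    have "(\<lambda>n. \<Sum>j\<in>I. \<bar>real n * (1 - margin F j (v n $ j)) - real n * (1 - margin F j (u n $ j))\<bar>)
        \<longlonglongrightarrow> (\<Sum>j\<in>I. \<bar>t j - t j\<bar>)"
      by (intro tendsto_sum tendsto_rabs tendsto_diff u v)
    then show "(\<lambda>n. \<Sum>j\<in>I. \<bar>real n * (1 - margin F j (v n $ j)) - real n * (1 - margin F j (u n $ j))\<bar>)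
        \<longlonglongrightarrow> 0" by simp
  qed
  from tendsto_diff[OF lim_v this]
  show "(\<lambda>n. real n * (1 - marginal_df F I (u n))) \<longlonglongrightarrow> - ln (marginal_df H I y)"
    by (simp add: algebra_simps)
qed

end

section \<open>The max-autoregressive chain\<close>

locale max_autoregression = prob_space M for M :: "'a measure" +
  fixes X Y :: "nat \<Rightarrow> 'a \<Rightarrow> real ^ 'd" and c :: "'d \<Rightarrow> real" and G F :: "(real ^ 'd) measure"
  assumes c_pos: "0 < c j" and c_less_1: "c j < 1"
    and indep: "indep_vars (\<lambda>_. borel) (\<lambda>n. if n = 0 then X 0 else Y n) UNIV"
    and distr_Y: "n \<ge> 1 \<Longrightarrow> distr M borel (Y n) = G"
    and recursion: "n \<ge> 1 \<Longrightarrow> \<omega> \<in> space M \<Longrightarrow>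
      X n \<omega> $ j = max (c j * X (n - 1) \<omega> $ j) (Y n \<omega> $ j)"
    and distr_X: "n \<ge> 1 \<Longrightarrow> distr M borel (X n) = F"
begin

lemma measurable_X0: "X 0 \<in> borel_measurable M"
  and measurable_Y: "n \<ge> 1 \<Longrightarrow> Y n \<in> borel_measurable M"
proof -
  have rv: "random_variable borel (if n = 0 then X 0 else Y n)" for n
    using indep unfolding indep_vars_def2 by blast
  show "X 0 \<in> borel_measurable M" using rv[of 0] by simp
  show "Y n \<in> borel_measurable M" if "n \<ge> 1" using rv[of n] that by simp
qed

text \<open>
  The law \<open>F\<close> of \<open>X n\<close> is a push-forward, which carries information only for measurable maps.
\<close>
lemma measurable_X: "X n \<in> borel_measurable M"
proof (induction n)
  case 0
  show ?case by (rule measurable_X0)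
next
  case (Suc n)
  note [measurable] = Suc measurable_Y[of "Suc n", simplified]
  have [measurable]: "(\<lambda>\<omega>. Z \<omega> $ j) \<in> borel_measurable M"
    if "Z \<in> borel_measurable M" for Z :: "'a \<Rightarrow> real ^ 'd" and j
    using measurable_compose[OF that measurable_vec_nth_borel] .
  have comp: "(\<lambda>\<omega>. X (Suc n) \<omega> $ j) \<in> borel_measurable M" for j
  proof -
    have "(\<lambda>\<omega>. max (c j * X n \<omega> $ j) (Y (Suc n) \<omega> $ j)) \<in> borel_measurable M" by measurable
    then show ?thesis by (rule measurable_cong[THEN iffD1, rotated]) (simp add: recursion)
  qed
  show ?case
  proof (rule borel_measurable_euclidean_space[THEN iffD2], rule ballI)
    fix e :: "real ^ 'd" assume "e \<in> Basis"
    then obtain j where "e = axis j 1" by (auto simp: Basis_vec_def)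
    then show "(\<lambda>\<omega>. X (Suc n) \<omega> \<bullet> e) \<in> borel_measurable M"
      using comp[of j] by (simp only: inner_axis inner_real_def mult_1_right)
  qed
qed

lemma prob_X0_and_innovations:
  assumes "S0 \<in> sets borel" and "\<And>i. i \<in> {1..n} \<Longrightarrow> S i \<in> sets borel"
  shows "\<P>(\<omega> in M. X 0 \<omega> \<in> S0 \<and> (\<forall>i\<in>{1..n}. Y i \<omega> \<in> S i))
    = \<P>(\<omega> in M. X 0 \<omega> \<in> S0) * (\<Prod>i\<in>{1..n}. measure G (S i))"
proof -
  let ?Z = "\<lambda>n. if n = 0 then X 0 else Y n" and ?T = "\<lambda>i. if i = 0 then S0 else S i"
  have ins: "{0..n} = insert 0 {1..n}" by auto
  have "{\<omega> \<in> space M. X 0 \<omega> \<in> S0 \<and> (\<forall>i\<in>{1..n}. Y i \<omega> \<in> S i)}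
      = (\<Inter>i\<in>{0..n}. ?Z i -` ?T i \<inter> space M)"
    unfolding ins by auto
  also have "prob \<dots> = (\<Prod>i\<in>{0..n}. prob (?Z i -` ?T i \<inter> space M))"
    by (rule indep_varsD[OF indep]) (use assms in auto)
  also have "\<dots> = prob (X 0 -` S0 \<inter> space M) * (\<Prod>i\<in>{1..n}. prob (?Z i -` ?T i \<inter> space M))"
    unfolding ins by simp
  also have "(\<Prod>i\<in>{1..n}. prob (?Z i -` ?T i \<inter> space M)) = (\<Prod>i\<in>{1..n}. measure G (S i))"
  proof (rule prod.cong)
    fix i assume i: "i \<in> {1..n}"
    then have "measure G (S i) = prob (Y i -` S i \<inter> space M)"
      using measure_distr[OF measurable_Y[of i] assms(2)[OF i]] distr_Y[of i] by simp
    then show "prob (?Z i -` ?T i \<inter> space M) = measure G (S i)" using i by simp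
  qed simp
  also have "X 0 -` S0 \<inter> space M = {\<omega> \<in> space M. X 0 \<omega> \<in> S0}" by auto
  finally show ?thesis .
qed

definition rescaled :: "real ^ 'd \<Rightarrow> real ^ 'd"
  where "rescaled u = (\<chi> j. u $ j / c j)"

lemma X_Suc_in_orthant_iff:
  assumes "\<omega> \<in> space M"
  shows "X (Suc n) \<omega> \<in> lower_orthant I u
    \<longleftrightarrow> X n \<omega> \<in> lower_orthant I (rescaled u) \<and> Y (Suc n) \<omega> \<in> lower_orthant I u"
proof -
  have "X (Suc n) \<omega> $ j \<le> u $ j \<longleftrightarrow> X n \<omega> $ j \<le> rescaled u $ j \<and> Y (Suc n) \<omega> $ j \<le> u $ j" for j
    using recursion[of "Suc n" \<omega> j] assms c_pos[of j]
    by (simp add: rescaled_def pos_le_divide_eq mult.commute)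
  then show ?thesis by (auto simp: lower_orthant_def)
qed

lemma lower_orthant_subset_rescaled:
  assumes "\<And>j. j \<in> I \<Longrightarrow> 0 \<le> u $ j"
  shows "lower_orthant I u \<subseteq> lower_orthant I (rescaled u)"
proof -
  have "u $ j \<le> u $ j / c j" if "j \<in> I" for j
    using assms[OF that] c_pos[of j] c_less_1[of j] mult_left_mono[of "c j" 1 "u $ j"]
    by (simp add: pos_le_divide_eq)
  then show ?thesis by (fastforce simp: lower_orthant_def rescaled_def)
qed

text \<open>
  For nonnegative levels \<open>u \<le> u / c\<close>, so a value below \<open>u\<close> stays below \<open>u\<close> after multiplication with
  \<open>c\<close>; only the start and the innovations can violate the bound.
\<close>
lemma path_below_iff:
  assumes u: "\<And>j. j \<in> I \<Longrightarrow> 0 \<le> u $ j" and \<omega>: "\<omega> \<in> space M"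
  shows "(\<forall>i\<in>{1..Suc n}. X i \<omega> \<in> lower_orthant I u)
    \<longleftrightarrow> X 0 \<omega> \<in> lower_orthant I (rescaled u) \<and> (\<forall>i\<in>{1..Suc n}. Y i \<omega> \<in> lower_orthant I u)"
proof (induction n)
  case 0
  show ?case using X_Suc_in_orthant_iff[OF \<omega>, of 0 I u] by simp
next
  case (Suc n)
  have split: "(\<forall>i\<in>{1..Suc (Suc n)}. P i) \<longleftrightarrow> (\<forall>i\<in>{1..Suc n}. P i) \<and> P (Suc (Suc n))" for P
    by (subst atLeastAtMostSuc_conv) auto
  have "X (Suc n) \<omega> \<in> lower_orthant I (rescaled u)" if "\<forall>i\<in>{1..Suc n}. X i \<omega> \<in> lower_orthant I u"
  proof -
    have "X (Suc n) \<omega> \<in> lower_orthant I u" using that by simp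
    with lower_orthant_subset_rescaled[OF u] show ?thesis by blast
  qed
  then show ?case
    unfolding split
    using Suc X_Suc_in_orthant_iff[OF \<omega>, of "Suc n" I u] by blast
qed

abbreviation initial_df :: "'d set \<Rightarrow> real ^ 'd \<Rightarrow> real"
  where "initial_df I x \<equiv> \<P>(\<omega> in M. X 0 \<omega> \<in> lower_orthant I x)"

lemma marginal_df_X:
  assumes "n \<ge> 1"
  shows "marginal_df F I u = \<P>(\<omega> in M. X n \<omega> \<in> lower_orthant I u)"
proof -
  have "marginal_df F I u = measure (distr M borel (X n)) (lower_orthant I u)"
    by (simp add: distr_X[OF assms] marginal_df_eq_measure)
  also have "\<dots> = prob (X n -` lower_orthant I u \<inter> space M)"
    by (rule measure_distr[OF measurable_X lower_orthant_borel])
  also have "X n -` lower_orthant I u \<inter> space M = {\<omega> \<in> space M. X n \<omega> \<in> lower_orthant I u}" by auto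
  finally show ?thesis .
qed

lemma marginal_df_first_step:
  "marginal_df F I u = initial_df I (rescaled u) * marginal_df G I u"
proof -
  have "marginal_df F I u = \<P>(\<omega> in M. X 0 \<omega> \<in> lower_orthant I (rescaled u)
      \<and> (\<forall>i\<in>{1..1}. Y i \<omega> \<in> lower_orthant I u))"
    unfolding marginal_df_X[of 1, simplified]
    by (intro arg_cong[of _ _ prob]) (use X_Suc_in_orthant_iff[of _ 0 I u] in auto)
  also have "\<dots> = initial_df I (rescaled u) * (\<Prod>i\<in>{1..1::nat}. measure G (lower_orthant I u))"
    by (rule prob_X0_and_innovations) (simp_all add: lower_orthant_borel)
  finally show ?thesis by (simp add: marginal_df_eq_measure)
qed

text \<open>
  Obtained by writing \<open>X 2\<close> and \<open>X 1\<close> in terms of \<open>X 0\<close>, \<open>Y 1\<close>, \<open>Y 2\<close>, whose independence is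
  given, instead of deriving independence of \<open>X 1\<close> and \<open>Y 2\<close>. The law of \<open>X 0\<close> cancels.
\<close>
lemma marginal_df_stationarity:
  "marginal_df F I u = marginal_df F I (rescaled u) * marginal_df G I u"
proof -
  let ?S = "\<lambda>i. if i = (1::nat) then lower_orthant I (rescaled u) else lower_orthant I u"
  have "marginal_df F I u = \<P>(\<omega> in M. X 0 \<omega> \<in> lower_orthant I (rescaled (rescaled u))
      \<and> (\<forall>i\<in>{1..2}. Y i \<omega> \<in> ?S i))"
    unfolding marginal_df_X[of 2, simplified]
  proof (intro arg_cong[of _ _ prob] Collect_cong conj_cong refl)
    fix \<omega> assume \<omega>: "\<omega> \<in> space M"
    have "{1..2} = {1, 2::nat}" by auto
    then show "X 2 \<omega> \<in> lower_orthant I u \<longleftrightarrow> X 0 \<omega> \<in> lower_orthant I (rescaled (rescaled u))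
        \<and> (\<forall>i\<in>{1..2}. Y i \<omega> \<in> ?S i)"
      using X_Suc_in_orthant_iff[OF \<omega>, of 0 I "rescaled u"] X_Suc_in_orthant_iff[OF \<omega>, of 1 I u]
      by (simp add: numeral_2_eq_2)
  qed
  also have "\<dots> = initial_df I (rescaled (rescaled u)) * (\<Prod>i\<in>{1..2::nat}. measure G (?S i))"
    by (rule prob_X0_and_innovations) (simp_all add: lower_orthant_borel)
  also have "(\<Prod>i\<in>{1..2::nat}. measure G (?S i)) = marginal_df G I (rescaled u) * marginal_df G I u"
    by (simp add: numeral_2_eq_2 marginal_df_eq_measure)
  finally show ?thesis by (simp add: marginal_df_first_step[of I "rescaled u"])
qed

text \<open>
  The law \<open>G\<close> of the innovations is eliminated through \<open>marginal_df_stationarity\<close>. The product form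
  remains valid where \<open>F(u / c)\<close> vanishes.
\<close>
lemma path_below_prob:
  assumes u: "\<And>j. j \<in> I \<Longrightarrow> 0 \<le> u $ j"
  shows "\<P>(\<omega> in M. \<forall>i\<in>{1..Suc n}. X i \<omega> \<in> lower_orthant I u) * marginal_df F I (rescaled u) ^ n
    = marginal_df F I u ^ Suc n"
proof -
  have "\<P>(\<omega> in M. \<forall>i\<in>{1..Suc n}. X i \<omega> \<in> lower_orthant I u)
      = \<P>(\<omega> in M. X 0 \<omega> \<in> lower_orthant I (rescaled u) \<and> (\<forall>i\<in>{1..Suc n}. Y i \<omega> \<in> lower_orthant I u))"
    by (intro arg_cong[of _ _ prob] Collect_cong conj_cong refl path_below_iff[OF u])
  also have "\<dots> = initial_df I (rescaled u) * (\<Prod>i\<in>{1..Suc n}. measure G (lower_orthant I u))"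
    by (rule prob_X0_and_innovations) (simp_all add: lower_orthant_borel)
  also have "\<dots> = marginal_df F I u * marginal_df G I u ^ n"
    by (simp add: marginal_df_first_step[of I u] marginal_df_eq_measure[of G])
  finally show ?thesis
    using marginal_df_stationarity[of I u] by (simp add: power_mult_distrib[symmetric] mult.assoc mult.commute)
qed

lemma multivariate_distribution_F: "multivariate_distribution F"
proof -
  have "prob_space (distr M borel (X 1))" by (rule prob_space_distr[OF measurable_X])
  then show ?thesis
    using distr_X[of 1]
    by (auto simp: multivariate_distribution_def multivariate_distribution_axioms_def)
qed

text \<open>
  For \<open>t < 0\<close> the point \<open>t / c\<close> lies below \<open>t\<close>, while stationarity gives \<open>F(t) \<le> F(t / c)\<close>.
  Iterating pushes the argument to minus infinity.
\<close>
lemma margin_eq_0: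
  assumes "t < 0"
  shows "margin F j t = 0"
proof -
  interpret F: multivariate_distribution F by (rule multivariate_distribution_F)
  have step: "margin F j s \<le> margin F j (s / c j)" for s
  proof -
    have "marginal_df G {j} (\<chi> i. s) \<le> 1"
    proof -
      interpret G: prob_space G
        using prob_space_distr[OF measurable_Y[of 1]] distr_Y[of 1] by simp
      show ?thesis by (simp add: marginal_df_def)
    qed
    then have "marginal_df F {j} (\<chi> i. s) \<le> marginal_df F {j} (rescaled (\<chi> i. s))"
      using marginal_df_stationarity[of "{j}" "\<chi> i. s"]
        mult_left_le[of "marginal_df G {j} (\<chi> i. s)" "marginal_df F {j} (rescaled (\<chi> i. s))"]
        F.marginal_df_nonneg by simp
    then show ?thesis
      by (simp add: F.margin_eq_marginal_df rescaled_def marginal_df_def)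
  qed
  have iter: "margin F j t \<le> margin F j (t * (1 / c j) ^ k)" for k
  proof (induction k)
    case (Suc k)
    then show ?case using step[of "t * (1 / c j) ^ k"] by (simp add: mult.assoc mult.commute)
  qed simp
  have "filterlim (\<lambda>k. inverse (c j ^ k)) at_top sequentially"
    using c_pos[of j] c_less_1[of j] by (intro filterlim_inverse_at_top LIMSEQ_realpow_zero) simp_all
  then have "filterlim (\<lambda>k. (1 / c j) ^ k) at_top sequentially"
    by (simp add: power_one_over inverse_eq_divide)
  then have "filterlim (\<lambda>k. t * (1 / c j) ^ k) at_bot sequentially"
    using assms by (intro filterlim_tendsto_neg_mult_at_bot[OF tendsto_const])
  from filterlim_compose[OF F.margin_at_bot this]
  have "(\<lambda>k. margin F j (t * (1 / c j) ^ k)) \<longlonglongrightarrow> 0" .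
  from LIMSEQ_le_const[OF this, of "margin F j t"] iter
  show ?thesis using F.margin_nonneg[of j t] by force
qed

text \<open>
  Convergence of the marginal tails to finite limits is what makes the levels eventually nonnegative: below 0
  the margins of \<open>F\<close> vanish, and \<open>n (1 - 0)\<close> is unbounded.
\<close>
lemma path_below_tendsto:
  fixes u :: "nat \<Rightarrow> real ^ 'd"
  assumes levels: "\<And>j. j \<in> I \<Longrightarrow> (\<lambda>n. real n * (1 - margin F j (u n $ j))) \<longlonglongrightarrow> t j"
    and A: "(\<lambda>n. real n * (1 - marginal_df F I (u n))) \<longlonglongrightarrow> A"
    and B: "(\<lambda>n. real n * (1 - marginal_df F I (rescaled (u n)))) \<longlonglongrightarrow> B"
  shows "(\<lambda>n. \<P>(\<omega> in M. \<forall>i\<in>{1..n}. X i \<omega> \<in> lower_orthant I (u n))) \<longlonglongrightarrow> exp (B - A)"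
proof -
  interpret F: multivariate_distribution F by (rule multivariate_distribution_F)
  have nonneg: "\<forall>\<^sub>F n in sequentially. \<forall>j\<in>I. 0 \<le> u n $ j"
  proof (rule eventually_ball_finite, simp, rule ballI)
    fix j assume "j \<in> I"
    have "(\<lambda>n. margin F j (u n $ j) ^ n) \<longlonglongrightarrow> exp (- t j)"
      by (rule tendsto_self_power_exp_iff[THEN iffD2, OF _ _ levels[OF \<open>j \<in> I\<close>]])
        (simp_all add: F.margin_nonneg F.margin_le_1)
    from order_tendstoD(1)[OF this exp_gt_zero] eventually_gt_at_top[of 0]
    show "\<forall>\<^sub>F n in sequentially. 0 \<le> u n $ j"
    proof eventually_elim
      case (elim n)
      then show ?case using margin_eq_0[of "u n $ j" j] by (cases "u n $ j < 0") (auto simp: zero_power)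
    qed
  qed
  define w where "w n = marginal_df F I (rescaled (u n))" for n
  have w1: "(\<lambda>n. 1 - w n) \<longlonglongrightarrow> 0"
  proof -
    have "(\<lambda>n. real n * (1 - w n) / real n) \<longlonglongrightarrow> 0"
      using real_tendsto_divide_at_top[OF B filterlim_real_sequentially] by (simp add: w_def)
    then show ?thesis
      by (rule Lim_transform_eventually)
        (use eventually_gt_at_top[of 0] in eventually_elim, simp)
  qed
  have "(\<lambda>n. real (n - 1) * (1 - w n)) \<longlonglongrightarrow> B"
  proof (rule Lim_transform_eventually)
    show "(\<lambda>n. real n * (1 - w n) - (1 - w n)) \<longlonglongrightarrow> B"
      using tendsto_diff[OF B[folded w_def] w1] by simp
    show "\<forall>\<^sub>F n in sequentially. real n * (1 - w n) - (1 - w n) = real (n - 1) * (1 - w n)"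
      using eventually_gt_at_top[of 0] by eventually_elim (simp add: of_nat_diff algebra_simps)
  qed
  then have w_power: "(\<lambda>n. w n ^ (n - 1)) \<longlonglongrightarrow> exp (- B)"
    by (intro tendsto_power_exp_iff[THEN iffD2] filterlim_minus_const_nat_at_top)
      (simp_all add: w_def F.marginal_df_nonneg F.marginal_df_le_1)
  have "(\<lambda>n. marginal_df F I (u n) ^ n) \<longlonglongrightarrow> exp (- A)"
    by (intro tendsto_self_power_exp_iff[THEN iffD2] A) (simp_all add: F.marginal_df_nonneg F.marginal_df_le_1)
  from tendsto_divide[OF this w_power]
  have "(\<lambda>n. marginal_df F I (u n) ^ n / w n ^ (n - 1)) \<longlonglongrightarrow> exp (B - A)"
    by (simp add: exp_diff exp_minus field_simps)
  then show ?thesis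
  proof (rule Lim_transform_eventually)
    show "\<forall>\<^sub>F n in sequentially. marginal_df F I (u n) ^ n / w n ^ (n - 1)
        = \<P>(\<omega> in M. \<forall>i\<in>{1..n}. X i \<omega> \<in> lower_orthant I (u n))"
      using nonneg order_tendstoD(1)[OF w_power exp_gt_zero] eventually_gt_at_top[of 0]
    proof eventually_elim
      case (elim n)
      obtain m where m: "n = Suc m" using elim by (cases n) auto
      from path_below_prob[of I "u n" m] elim
      have eq: "\<P>(\<omega> in M. \<forall>i\<in>{1..n}. X i \<omega> \<in> lower_orthant I (u n)) * w n ^ (n - 1)
          = marginal_df F I (u n) ^ n"
        unfolding m w_def by simp
      have "w n ^ (n - 1) \<noteq> 0" using elim by linarith
      then show ?case unfolding eq[symmetric] by (rule nonzero_mult_div_cancel_right)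
    qed
  qed
qed

end

section \<open>Extremal indices of the chain\<close>

lemma prob_iid_max_le:
  assumes "prob_space N" and N: "sets N = sets borel" and "n \<ge> 1"
  shows "\<P>(\<omega> in PiM {1..n} (\<lambda>_. N). comp_max (\<lambda>i \<omega>. \<omega> i) n \<omega> \<le> x) = joint_df N x ^ n"
proof -
  interpret N: prob_space N by fact
  interpret finite_product_prob_space "\<lambda>_. N" "{1..n}"
    by unfold_locales simp
  have "{\<omega> \<in> space (PiM {1..n} (\<lambda>_. N)). comp_max (\<lambda>i \<omega>. \<omega> i) n \<omega> \<le> x} = PiE {1..n} (\<lambda>_. {..x})"
    using \<open>n \<ge> 1\<close> sets_eq_imp_space_eq[OF N]
    by (auto simp: space_PiM comp_max_def less_eq_vec_def PiE_iff extensional_def)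
  moreover have "{..x} \<in> sets N"
    using lower_orthant_borel[of UNIV x]
    by (simp add: N lower_orthant_def less_eq_vec_def atMost_def)
  ultimately show ?thesis
    using prob_times[of "\<lambda>_. {..x}"] by (simp add: joint_df_def)
qed

locale extremal_autoregression =
  max_autoregression M X Y c G F + max_domain F H a b
  for M :: "'a measure" and X Y :: "nat \<Rightarrow> 'a \<Rightarrow> real ^ 'd" and c :: "'d \<Rightarrow> real"
    and G F H :: "(real ^ 'd) measure" and a b :: "nat \<Rightarrow> real ^ 'd" +
  fixes \<alpha> :: "'d \<Rightarrow> real"
  assumes \<alpha>_pos: "0 < \<alpha> j"
    and margin_type: "margin H j \<in> {gumbel, weibull (\<alpha> j), frechet (\<alpha> j)}"
begin

definition tail_point :: "'d \<Rightarrow> real \<Rightarrow> real"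
  where "tail_point j t = df_inverse (margin H j) (exp (- t))"

lemma margin_tail_point: "0 < t \<Longrightarrow> margin H j (tail_point j t) = exp (- t)"
  unfolding tail_point_def by (rule extreme_value_type_inverse(1)[OF margin_type \<alpha>_pos])

lemma canonical_levels:
  assumes "0 < t"
  shows "(\<lambda>n. real n * (1 - margin F j (a n $ j * tail_point j t + b n $ j))) \<longlonglongrightarrow> t"
  using margin_power_tendsto[of j "tail_point j t"] margin_tail_point[OF assms, of j]
  by (intro tendsto_self_power_exp_iff[THEN iffD1])
    (simp_all add: F.margin_nonneg F.margin_le_1)

lemma scaled_levels_heavy:
  assumes "margin H j = frechet (\<alpha> j)" "0 < t"
    and v: "(\<lambda>n. real n * (1 - margin F j (v n))) \<longlonglongrightarrow> t"
  shows "(\<lambda>n. real n * (1 - margin F j (v n / c j))) \<longlonglongrightarrow> t * c j powr \<alpha> j"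
  by (rule frechet_tail_scaled_levels[where a = "\<lambda>n. a n $ j" and b = "\<lambda>n. b n $ j"])
    (use assms margin_power_tendsto[of j] F.mono_margin F.margin_nonneg F.margin_le_1 a_pos \<alpha>_pos c_pos
      in simp_all)

lemma scaled_levels_light:
  assumes H: "margin H j \<noteq> frechet (\<alpha> j)" and t: "0 < t"
    and v: "(\<lambda>n. real n * (1 - margin F j (v n))) \<longlonglongrightarrow> t"
  shows "(\<lambda>n. real n * (1 - margin F j (v n / c j))) \<longlonglongrightarrow> 0"
proof (rule light_tail_scaled_levels[where a = "\<lambda>n. a n $ j" and b = "\<lambda>n. b n $ j" and h = "margin H j"
      and \<xi> = "tail_point j t" and t = t])
  have "margin H j \<in> {gumbel, weibull (\<alpha> j)}" using margin_type[of j] H by auto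
  then show "0 < margin H j x" for x by (auto simp: gumbel_def weibull_def)
  show "margin H j y < margin H j (tail_point j t)" if "y < tail_point j t" for y
    using extreme_value_type_inverse(2)[OF margin_type \<alpha>_pos t, folded tail_point_def, OF that]
    by (simp only: margin_tail_point[OF t])
  show "margin H j (tail_point j t) < margin H j y" if "tail_point j t < y" for y
    using extreme_value_type_inverse(3)[OF margin_type \<alpha>_pos t, folded tail_point_def, OF that]
    by (simp only: margin_tail_point[OF t])
qed (fact F.mono_margin F.margin_nonneg F.margin_le_1 margin_eq_0 a_pos margin_power_tendsto
      H.margin_at_top margin_tail_point[OF t] c_pos c_less_1 v)+

text \<open>
  At the levels \<open>u / c\<close> the coordinates outside \<open>I\<close> have negligible tails, so the limit there is that of the
  \<open>I\<close>-marginal of \<open>H\<close>.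
\<close>
lemma multivariate_extremal_index:
  fixes \<tau> :: "real ^ 'd"
  defines "I \<equiv> {j. margin H j = frechet (\<alpha> j)}"
    and "u \<equiv> \<lambda>n. \<chi> j. a n $ j * tail_point j (\<tau> $ j) + b n $ j"
  assumes \<tau>: "\<And>j. 0 < \<tau> $ j"
  shows "0 < copula H (\<chi> j. exp (- (\<tau> $ j)))" and "copula H (\<chi> j. exp (- (\<tau> $ j))) < 1"
    and "(\<lambda>n. joint_df F (u n) ^ n) \<longlonglongrightarrow> copula H (\<chi> j. exp (- (\<tau> $ j)))"
    and "(\<lambda>n. \<P>(\<omega> in M. \<forall>i\<in>{1..n}. X i \<omega> \<in> lower_orthant UNIV (u n)))
      \<longlonglongrightarrow> copula H (\<chi> j. exp (- (\<tau> $ j)))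
        powr (1 - (if I = {} then 0 else ln (marginal_copula H I (\<chi> j. exp (- (\<tau> $ j * c j powr \<alpha> j)))))
          / ln (copula H (\<chi> j. exp (- (\<tau> $ j)))))"
proof -
  define y where "y = (\<chi> j. tail_point j (\<tau> $ j))"
  define z where "z = (\<chi> j. tail_point j (\<tau> $ j * c j powr \<alpha> j))"
  have copula: "copula H (\<chi> j. exp (- (\<tau> $ j))) = marginal_df H UNIV y"
    by (simp add: copula_def joint_df_eq_marginal_df y_def tail_point_def)
  have mcopula: "marginal_copula H I (\<chi> j. exp (- (\<tau> $ j * c j powr \<alpha> j))) = marginal_df H I z"
    by (simp add: marginal_copula_def z_def tail_point_def)
  have u: "(\<lambda>n. real n * (1 - margin F j (u n $ j))) \<longlonglongrightarrow> \<tau> $ j" for j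
    using canonical_levels[OF \<tau>, of j j] by (simp add: u_def)
  have y: "margin H j (y $ j) = exp (- (\<tau> $ j))" for j
    by (simp add: y_def margin_tail_point \<tau>)
  note A = marginal_df_tail_tendsto[of UNIV u "\<lambda>j. \<tau> $ j" y, OF u y]
  have z: "margin H j (z $ j) = exp (- (\<tau> $ j * c j powr \<alpha> j))" for j
    using c_pos[of j] by (simp add: z_def margin_tail_point \<tau>)
  have B: "(\<lambda>n. real n * (1 - marginal_df F UNIV (rescaled (u n)))) \<longlonglongrightarrow> - ln (marginal_df H I z)"
  proof (rule F.marginal_df_tail_extend)
    show "(\<lambda>n. real n * (1 - marginal_df F I (rescaled (u n)))) \<longlonglongrightarrow> - ln (marginal_df H I z)"
    proof (rule marginal_df_tail_tendsto(2)[OF _ z])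
      fix j assume "j \<in> I"
      then show "(\<lambda>n. real n * (1 - margin F j (rescaled (u n) $ j))) \<longlonglongrightarrow> \<tau> $ j * c j powr \<alpha> j"
        using scaled_levels_heavy[OF _ \<tau> u, of j] by (simp add: I_def rescaled_def)
    qed
    show "(\<lambda>n. real n * (1 - margin F j (rescaled (u n) $ j))) \<longlonglongrightarrow> 0" if "j \<in> UNIV - I" for j
      using scaled_levels_light[OF _ \<tau> u, of j] that by (simp add: I_def rescaled_def)
  qed simp
  show pos: "0 < copula H (\<chi> j. exp (- (\<tau> $ j)))" unfolding copula by (rule A(1))
  have "marginal_df H UNIV y \<le> exp (- (\<tau> $ undefined))"
    using H.marginal_df_le_margin[of undefined UNIV y] y by simp
  also have "\<dots> < 1" using \<tau> by simp
  finally show less_1: "copula H (\<chi> j. exp (- (\<tau> $ j))) < 1" unfolding copula .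
  show "(\<lambda>n. joint_df F (u n) ^ n) \<longlonglongrightarrow> copula H (\<chi> j. exp (- (\<tau> $ j)))"
    using joint_df_power_tendsto[of y] by (simp add: copula joint_df_eq_marginal_df u_def y_def)
  let ?\<gamma> = "marginal_df H UNIV y"
  have "?\<gamma> powr (1 - (if I = {} then 0 else ln (marginal_df H I z)) / ln ?\<gamma>)
      = exp (- ln (marginal_df H I z) - - ln ?\<gamma>)"
  proof -
    have "(if I = {} then 0 else ln (marginal_df H I z)) = ln (marginal_df H I z)"
      by (simp add: H.marginal_df_empty)
    then show ?thesis
      using pos less_1 by (simp add: copula powr_def left_diff_distrib)
  qed
  then show "(\<lambda>n. \<P>(\<omega> in M. \<forall>i\<in>{1..n}. X i \<omega> \<in> lower_orthant UNIV (u n)))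
      \<longlonglongrightarrow> copula H (\<chi> j. exp (- (\<tau> $ j)))
        powr (1 - (if I = {} then 0 else ln (marginal_copula H I (\<chi> j. exp (- (\<tau> $ j * c j powr \<alpha> j)))))
          / ln (copula H (\<chi> j. exp (- (\<tau> $ j)))))"
    unfolding copula mcopula using path_below_tendsto[OF u A(2) B] by simp
qed

lemma component_max_tendsto:
  assumes t: "0 < t" and v: "(\<lambda>n. real n * (1 - margin F j (v n))) \<longlonglongrightarrow> t"
  shows "(\<lambda>n. \<P>(\<omega> in M. \<forall>i\<in>{1..n}. X i \<omega> $ j \<le> v n)) \<longlonglongrightarrow>
    exp (- (if margin H j = frechet (\<alpha> j) then 1 - c j powr \<alpha> j else 1) * t)"
proof -
  let ?B = "if margin H j = frechet (\<alpha> j) then t * c j powr \<alpha> j else 0"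
  have marg: "marginal_df F {j} x = margin F j (x $ j)" for x
    by (simp add: F.margin_eq_measure marginal_df_def)
  have "(\<lambda>n. \<P>(\<omega> in M. \<forall>i\<in>{1..n}. X i \<omega> \<in> lower_orthant {j} (\<chi> _. v n))) \<longlonglongrightarrow> exp (?B - t)"
  proof (rule path_below_tendsto)
    show "(\<lambda>n. real n * (1 - margin F i ((\<chi> _. v n) $ i))) \<longlonglongrightarrow> t" if "i \<in> {j}" for i
      using v that by simp
    show "(\<lambda>n. real n * (1 - marginal_df F {j} (\<chi> _. v n))) \<longlonglongrightarrow> t"
      using v by (simp add: marg)
    show "(\<lambda>n. real n * (1 - marginal_df F {j} (rescaled (\<chi> _. v n)))) \<longlonglongrightarrow> ?B"
      using scaled_levels_heavy[OF _ t v] scaled_levels_light[OF _ t v]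
      by (simp add: marg rescaled_def)
  qed
  then show ?thesis
    by (simp add: lower_orthant_def algebra_simps split: if_splits)
qed

lemma prob_exceed: "\<P>(\<omega> in M. X 1 \<omega> $ j > s) = 1 - margin F j s"
proof -
  let ?B = "{\<omega> \<in> space M. X 1 \<omega> \<in> lower_orthant {j} (\<chi> i. s)}"
  have "?B = X 1 -` lower_orthant {j} (\<chi> i. s) \<inter> space M" by auto
  then have "?B \<in> events" using measurable_sets[OF measurable_X lower_orthant_borel] by simp
  then have "prob (space M - ?B) = 1 - prob ?B" by (rule prob_compl)
  also have "space M - ?B = {\<omega> \<in> space M. X 1 \<omega> $ j > s}"
    by (auto simp: lower_orthant_def)
  also have "prob ?B = margin F j s"
    unfolding F.margin_eq_marginal_df by (rule marginal_df_X[symmetric]) simp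
  finally show ?thesis .
qed

end

theorem proposition4p1:
  fixes M :: "'a measure"
    and X Y :: "nat \<Rightarrow> 'a \<Rightarrow> real ^ 'd"
    and F G H :: "(real ^ 'd) measure"
    and c \<alpha> :: "'d \<Rightarrow> real"
    and I :: "'d set"
  assumes "prob_space M"
    and "\<And>j. 0 < c j \<and> c j < 1"
    and "prob_space.indep_vars M (\<lambda>_. borel) (\<lambda>n. if n = 0 then X 0 else Y n) UNIV"
    and "\<And>n. n \<ge> 1 \<Longrightarrow> distr M borel (Y n) = G"
    and "\<And>n j \<omega>. n \<ge> 1 \<Longrightarrow> \<omega> \<in> space M \<Longrightarrow>
           X n \<omega> $ j = max (c j * X (n - 1) \<omega> $ j) (Y n \<omega> $ j)"
    and "stationary_seq M X"
    and "\<And>n. n \<ge> 1 \<Longrightarrow> distr M borel (X n) = F"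
    and "prob_space H" and "sets H = sets borel"
    and "\<And>j. 0 < \<alpha> j"
    and "\<And>j. margin H j \<in> {gumbel, weibull (\<alpha> j), frechet (\<alpha> j)}"
    and "in_max_domain F H"
    and "I = {j. margin H j = frechet (\<alpha> j)}"
  shows "has_multivariate_extremal_index M X
           (\<lambda>\<tau>. 1 - (if I = {} then 0
                      else ln (marginal_copula H I (\<chi> j. exp (- (\<tau> $ j * c j powr \<alpha> j)))))
                    / ln (copula H (\<chi> j. exp (- (\<tau> $ j)))))
         \<and> (\<forall>j. has_extremal_index M (\<lambda>n \<omega>. X n \<omega> $ j)
               (if margin H j \<in> {gumbel, weibull (\<alpha> j)} then 1 else 1 - c j powr \<alpha> j))"
proof -
  interpret AR: max_autoregression M X Y c G F
  proof (rule max_autoregression.intro[OF assms(1)], unfold_locales)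
  qed (use assms(2-5,7) in auto)
  obtain a b :: "nat \<Rightarrow> real ^ 'd" where ab: "\<And>n j. 0 < a n $ j"
    "\<And>x. (\<lambda>n. joint_df F (\<chi> j. a n $ j * x $ j + b n $ j) ^ n) \<longlonglongrightarrow> joint_df H x"
    using assms(12) by (auto simp: in_max_domain_def)
  interpret F: multivariate_distribution F by (rule AR.multivariate_distribution_F)
  interpret H: multivariate_distribution H
    by (intro multivariate_distribution.intro multivariate_distribution_axioms.intro assms(8,9))
  interpret extremal_autoregression M X Y c G F H a b \<alpha>
    by unfold_locales (use ab assms(10,11) in auto)
  have max_le: "(MAX i\<in>{1..n}. f i) \<le> s \<longleftrightarrow> (\<forall>i\<in>{1..n}. f i \<le> s)" if "n \<ge> 1" for n s and f :: "nat \<Rightarrow> real"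
    using that by (subst Max_le_iff) auto
  show ?thesis
  proof (intro conjI allI)
    have comp_max_le: "comp_max X n \<omega> \<le> x \<longleftrightarrow> (\<forall>i\<in>{1..n}. X i \<omega> \<in> lower_orthant UNIV x)"
      if "n \<ge> 1" for n \<omega> x
      using max_le[OF that] by (auto simp: comp_max_def less_eq_vec_def lower_orthant_def)
    show "has_multivariate_extremal_index M X
           (\<lambda>\<tau>. 1 - (if I = {} then 0
                      else ln (marginal_copula H I (\<chi> j. exp (- (\<tau> $ j * c j powr \<alpha> j)))))
                    / ln (copula H (\<chi> j. exp (- (\<tau> $ j)))))"
      unfolding has_multivariate_extremal_index_def
    proof (intro exI[of _ "\<lambda>j t n. a n $ j * tail_point j t + b n $ j"] allI impI conjI)
      fix \<tau> :: "real ^ 'd" and j assume "\<forall>j. 0 < \<tau> $ j"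
      then show "(\<lambda>n. real n * \<P>(\<omega> in M. X 1 \<omega> $ j > a n $ j * tail_point j (\<tau> $ j) + b n $ j)) \<longlonglongrightarrow> \<tau> $ j"
        unfolding prob_exceed by (intro canonical_levels) simp
    next
      fix \<tau> :: "real ^ 'd" assume "\<forall>j. 0 < \<tau> $ j"
      then have \<tau>: "0 < \<tau> $ j" for j by simp
      note lims = multivariate_extremal_index[of \<tau>, OF \<tau>, folded assms(13)]
      let ?u = "\<lambda>n. \<chi> j. a n $ j * tail_point j (\<tau> $ j) + b n $ j"
      let ?\<theta> = "1 - (if I = {} then 0
                      else ln (marginal_copula H I (\<chi> j. exp (- (\<tau> $ j * c j powr \<alpha> j)))))
                    / ln (copula H (\<chi> j. exp (- (\<tau> $ j))))"
      have iid: "(\<lambda>n. \<P>(\<omega> in PiM {1..n} (\<lambda>_. distr M borel (X 1)).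
          comp_max (\<lambda>i \<omega>. \<omega> i) n \<omega> \<le> ?u n)) \<longlonglongrightarrow> copula H (\<chi> j. exp (- (\<tau> $ j)))"
        by (rule Lim_transform_eventually[OF lims(3)], use eventually_ge_at_top[of 1] in eventually_elim)
          (simp only: assms(7)[OF order_refl] prob_iid_max_le[OF F.prob_space_axioms F.sets_eq_borel])
      have dep: "(\<lambda>n. \<P>(\<omega> in M. comp_max X n \<omega> \<le> ?u n)) \<longlonglongrightarrow> copula H (\<chi> j. exp (- (\<tau> $ j))) powr ?\<theta>"
        by (rule Lim_transform_eventually[OF lims(4)], use eventually_ge_at_top[of 1] in eventually_elim)
          (simp add: comp_max_le)
      show "\<exists>\<gamma>. 0 < \<gamma> \<and> \<gamma> < 1 \<and>
          (\<lambda>n. \<P>(\<omega> in PiM {1..n} (\<lambda>_. distr M borel (X 1)). comp_max (\<lambda>i \<omega>. \<omega> i) n \<omega> \<le> ?u n)) \<longlonglongrightarrow> \<gamma> \<and>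
          (\<lambda>n. \<P>(\<omega> in M. comp_max X n \<omega> \<le> ?u n)) \<longlonglongrightarrow> \<gamma> powr ?\<theta>"
        using lims(1,2) iid dep by blast
    qed
  next
    fix j
    \<comment> \<open>the value at \<open>- 1\<close> tells the Frechet law from the other two types\<close>
    have "frechet (\<alpha> j) (- 1) = 0" "gumbel (- 1) \<noteq> 0" "weibull (\<alpha> j) (- 1) \<noteq> 0"
      by (simp_all add: frechet_def gumbel_def weibull_def)
    then have \<theta>: "(if margin H j \<in> {gumbel, weibull (\<alpha> j)} then 1 else 1 - c j powr \<alpha> j)
        = (if margin H j = frechet (\<alpha> j) then 1 - c j powr \<alpha> j else 1)"
      using margin_type[of j] by auto
    show "has_extremal_index M (\<lambda>n \<omega>. X n \<omega> $ j)
        (if margin H j \<in> {gumbel, weibull (\<alpha> j)} then 1 else 1 - c j powr \<alpha> j)"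
      unfolding has_extremal_index_def \<theta> prob_exceed
    proof (intro allI impI conjI)
      fix t :: real assume "0 < t"
      show "\<exists>u. (\<lambda>n. real n * (1 - margin F j (u n))) \<longlonglongrightarrow> t"
        by (rule exI, rule canonical_levels[OF \<open>0 < t\<close>])
      fix u assume "(\<lambda>n. real n * (1 - margin F j (u n))) \<longlonglongrightarrow> t"
      from component_max_tendsto[OF \<open>0 < t\<close> this]
      show "(\<lambda>n. \<P>(\<omega> in M. (MAX i\<in>{1..n}. X i \<omega> $ j) \<le> u n)) \<longlonglongrightarrow>
          exp (- (if margin H j = frechet (\<alpha> j) then 1 - c j powr \<alpha> j else 1) * t)"
        by (rule Lim_transform_eventually, use eventually_ge_at_top[of 1] in eventually_elim)
          (simp add: max_le)
    qed
  qed
qed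

end
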